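(* Fix a cyclic element $W=\sum_{j=0}^N r_jR_{\alpha_j}$ of $\mathfrak g_1^\sigma$ such that $m_{\pi(j)}=\overline{m_j}$ and $\overline{R_{\alpha_j}}=R_{-\alpha_{\pi(j)}}$ for $j=0,\ldots,N$, where we take $m_j=r_j\overline{r_j}$ for $j=0,\ldots,N$. Then the affine Toda field equation $$2\Omega_{z\bar z}=\sum_{j=0}^N m_j\,e^{2\alpha_j(\Omega)}\,\alpha_j^\sharp$$ for smooth maps $\Omega:\mathbb C\to i\mathfrak t$ is the integrability condition for the existence of a Toda frame with respect to $W$.
   Context: Setting. $G$ is a simple real Lie group: it is connected and its Lie algebra $\mathfrak g$ is simple, with $\mathfrak g^{\mathbb C}$ simple. $\mathfrak t\subset\mathfrak g$ is a Cartan subalgebra and $T$ a Cartan subgroup with Lie algebra $\mathfrak t$; $\alpha_1,\ldots,\alpha_N$ are simple roots for the root system of $(\mathfrak g^{\mathbb C},\mathfrak t^{\mathbb C})$, with dual basis $\eta_1,\dots,\eta_N$ of $\mathfrak t^{\mathbb C}$, $\alpha_i(\eta_j)=\delta_{ij}$. The height of $\sum n_j\alpha_j$ is $\sum n_j$; $\alpha_0$ is the lowest root and $k-1$ is the maximal height of a root. The Coxeter automorphism $\sigma=\mathrm{Ad}_{\exp\left(\frac{2\pi i}{k}\sum_j\eta_j\right)}$ of $\mathfrak g^{\mathbb C}$ has order $k$, and it is assumed that it preserves the real group $G$, making $G/T$ a $k$-symmetric space, with $k>2$. The $e^{2\pi i/k}$-eigenspace of $\sigma$ is $\mathfrak g_1^\sigma=\bigoplus_{j=0}^N\mathcal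 G^{\alpha_j}$, where $\mathcal G^\alpha$ is the root space of $\alpha$; an element of it is cyclic if its projection to each $\mathcal G^{\alpha_j}$, $j=0,\ldots,N$, is non-zero. Bars on elements of $\mathfrak g^{\mathbb C}$ denote conjugation with respect to $\mathfrak g$, and $\bar\alpha(X)=\overline{\alpha(\bar X)}$ for roots $\alpha$. Since $\sigma$ preserves $\mathfrak g$, there is a permutation $\pi$ of $\{0,\ldots,N\}$ with $\overline{\alpha_j}=-\alpha_{\pi(j)}$. The $R_{\pm\alpha_j}\in\mathcal G^{\pm\alpha_j}$ are (non-zero) root vectors, and $\alpha_j^\sharp\in\mathfrak t^{\mathbb C}$ is the dual of $\alpha_j$ with respect to the Killing form. For $F:\mathbb C\to G$, $F^{-1}F_z\,dz$ denotes the $dz$-part of the pullback $F^{-1}dF$ of the left-invariant Maurer–Cartan form of $G$. A lift $F:\mathbb C\to G$ of a map $\psi:\mathbb C\to G/T$ is a Toda frame with respect to $W$ if there is a smooth map $\Omega:\mathbb C\to i\mathfrak t$ with $F^{-1}F_z=\Omega_z+\mathrm{Ad}_{\exp\Omega}W$. The integrability condition, for a given smooth $\Omega:\mathbb C\to i\mathfrak t$, is the zero-curvature (Maurer–Cartan) equation for the $\mathfrak g$-valued one-form $(\Omega_z+\mathrm{Ad}_{\exp\Omega}W)\,dz+(-\Omega_{\bar z}+\mathrm{Ad}_{\exp(-\Omega)}\overline W)\,d\bar z$, which is the condition for this form to equal $F^{-1}dF$ for some $F:\mathbb C\to G$.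
   Formalization: The coefficient is corrected from m_j = r_j·conj(r_j) to m_j = r_j·conj(r_{π(j)})·B(R_{α_j}, R_{-α_j}), B the Killing form; the printed formula fails for general root vectors, e.g. for SU(3), and the condition m_{π(j)} = conj(m_j) is then automatic. *)

theory Defs
  imports "HOL-Analysis.Analysis"
begin

section \<open>Lie algebras over a field\<close>

locale lie_algebra = vector_space scale
  for scale :: "'k::field \<Rightarrow> 'v::ab_group_add \<Rightarrow> 'v" +
  fixes bracket :: "'v \<Rightarrow> 'v \<Rightarrow> 'v"
  assumes bracket_add_left: "bracket (x + y) z = bracket x z + bracket y z"
    and bracket_add_right: "bracket x (y + z) = bracket x y + bracket x z"
    and bracket_scale_left: "bracket (scale c x) y = scale c (bracket x y)"
    and bracket_scale_right: "bracket x (scale c y) = scale c (bracket x y)"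
    and bracket_alternating: "bracket x x = 0"
    and jacobi: "bracket x (bracket y z) + bracket y (bracket z x) + bracket z (bracket x y) = 0"
begin

definition lie_ideal :: "'v set \<Rightarrow> bool" where
  "lie_ideal I \<longleftrightarrow> subspace I \<and> (\<forall>x. \<forall>y\<in>I. bracket x y \<in> I)"

definition simple_lie :: bool where
  "simple_lie \<longleftrightarrow> (\<exists>x y. bracket x y \<noteq> 0) \<and> (\<forall>I. lie_ideal I \<longrightarrow> I = {0} \<or> I = UNIV)"

definition abelian_subalgebra :: "'v set \<Rightarrow> bool" where
  "abelian_subalgebra h \<longleftrightarrow> subspace h \<and> (\<forall>x\<in>h. \<forall>y\<in>h. bracket x y = 0)"

definition diagonalizable_endo :: "('v \<Rightarrow> 'v) \<Rightarrow> bool" where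
  "diagonalizable_endo f \<longleftrightarrow> (\<exists>B. independent B \<and> span B = UNIV \<and> (\<forall>b\<in>B. \<exists>c. f b = scale c b))"

text \<open>
  Cartan subalgebras of a semisimple Lie algebra over an algebraically closed field: maximal abelian
  subalgebras all of whose elements are ad-semisimple.
\<close>
definition cartan_subalgebra :: "'v set \<Rightarrow> bool" where
  "cartan_subalgebra h \<longleftrightarrow>
     abelian_subalgebra h \<and>
     (\<forall>h'. abelian_subalgebra h' \<and> h \<subseteq> h' \<longrightarrow> h' = h) \<and>
     (\<forall>x\<in>h. diagonalizable_endo (bracket x))"

text \<open>Only meaningful in finite dimension, where the trace does not depend on the chosen basis.\<close>
definition endo_trace :: "('v \<Rightarrow> 'v) \<Rightarrow> 'k" where
  "endo_trace f = (\<Sum>b\<in>extend_basis {}. representation (extend_basis {}) (f b) b)"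

definition killing :: "'v \<Rightarrow> 'v \<Rightarrow> 'k" where
  "killing x y = endo_trace (\<lambda>z. bracket x (bracket y z))"

definition root_space :: "'v set \<Rightarrow> ('v \<Rightarrow> 'k) \<Rightarrow> 'v set" where
  "root_space h a = {x. \<forall>H\<in>h. bracket H x = scale (a H) x}"

text \<open>
  Roots are functionals on \<^term>\<open>h\<close>. They are extended by zero to the whole type (not linearly), so that
  equality of functions is equality of functionals on \<^term>\<open>h\<close>. Sums and negatives respect this convention,
  and linearity on \<^term>\<open>h\<close> is forced by the non-zero root vector.
\<close>
definition roots :: "'v set \<Rightarrow> ('v \<Rightarrow> 'k) set" where
  "roots h = {a. (\<forall>x. x \<notin> h \<longrightarrow> a x = 0) \<and> (\<exists>H\<in>h. a H \<noteq> 0) \<and> (\<exists>x\<in>root_space h a. x \<noteq> 0)}"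

definition killing_sharp :: "'v set \<Rightarrow> ('v \<Rightarrow> 'k) \<Rightarrow> 'v" where
  "killing_sharp h a = (THE H. H \<in> h \<and> (\<forall>H'\<in>h. killing H H' = a H'))"

definition simple_system :: "'v set \<Rightarrow> nat \<Rightarrow> (nat \<Rightarrow> 'v \<Rightarrow> 'k) \<Rightarrow> bool" where
  "simple_system h N \<alpha> \<longleftrightarrow>
     (\<forall>i\<in>{1..N}. \<alpha> i \<in> roots h) \<and>
     (\<forall>c. (\<forall>H\<in>h. (\<Sum>i=1..N. c i * \<alpha> i H) = 0) \<longrightarrow> (\<forall>i\<in>{1..N}. c i = 0)) \<and>
     (\<forall>\<beta>\<in>roots h. \<exists>n :: nat \<Rightarrow> nat.
        \<beta> = (\<lambda>H. \<Sum>i=1..N. of_nat (n i) * \<alpha> i H) \<or>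
        \<beta> = (\<lambda>H. - (\<Sum>i=1..N. of_nat (n i) * \<alpha> i H)))"

definition root_heights :: "'v set \<Rightarrow> nat \<Rightarrow> (nat \<Rightarrow> 'v \<Rightarrow> 'k) \<Rightarrow> int set" where
  "root_heights h N \<alpha> =
     {(\<Sum>i=1..N. n i) |n :: nat \<Rightarrow> int. (\<lambda>H. \<Sum>i=1..N. of_int (n i) * \<alpha> i H) \<in> roots h}"

definition lowest_root :: "'v set \<Rightarrow> nat \<Rightarrow> (nat \<Rightarrow> 'v \<Rightarrow> 'k) \<Rightarrow> ('v \<Rightarrow> 'k) \<Rightarrow> bool" where
  "lowest_root h N \<alpha> \<theta> \<longleftrightarrow>
     \<theta> \<in> roots h \<and>
     (\<forall>\<beta>\<in>roots h. \<exists>n :: nat \<Rightarrow> nat. \<beta> = (\<lambda>H. \<theta> H + (\<Sum>i=1..N. of_nat (n i) * \<alpha> i H)))"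

definition dual_basis :: "'v set \<Rightarrow> nat \<Rightarrow> (nat \<Rightarrow> 'v \<Rightarrow> 'k) \<Rightarrow> (nat \<Rightarrow> 'v) \<Rightarrow> bool" where
  "dual_basis h N \<alpha> \<eta> \<longleftrightarrow>
     span (\<eta> ` {1..N}) = h \<and>
     (\<forall>i\<in>{1..N}. \<forall>j\<in>{1..N}. \<alpha> i (\<eta> j) = (if i = j then 1 else 0))"

end

section \<open>Complexification of a real Lie algebra\<close>

text \<open>
  The real Lie algebra is a type \<^typ>\<open>'g::euclidean_space\<close> with a bracket; the inner product only serves to
  provide finite dimension and the topology. The pair \<^term>\<open>(x, y)\<close> stands for x + iy.
\<close>
type_synonym 'g complexified = "'g \<times> 'g"

definition cscale :: "complex \<Rightarrow> 'g::real_vector complexified \<Rightarrow> 'g complexified" where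
  "cscale c X = (Re c *\<^sub>R fst X - Im c *\<^sub>R snd X, Im c *\<^sub>R fst X + Re c *\<^sub>R snd X)"

definition cbracket :: "('g::real_vector \<Rightarrow> 'g \<Rightarrow> 'g) \<Rightarrow> 'g complexified \<Rightarrow> 'g complexified \<Rightarrow> 'g complexified" where
  "cbracket br X Y = (br (fst X) (fst Y) - br (snd X) (snd Y), br (fst X) (snd Y) + br (snd X) (fst Y))"

definition cconj :: "'g::real_vector complexified \<Rightarrow> 'g complexified" where
  "cconj X = (fst X, - snd X)"

definition real_form :: "'g::real_vector complexified set" where
  "real_form = UNIV \<times> {0}"

definition complexify :: "'g::real_vector set \<Rightarrow> 'g complexified set" where
  "complexify t = t \<times> t"

definition imag_part :: "'g::real_vector set \<Rightarrow> 'g complexified set" where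
  "imag_part t = {0} \<times> t"

lemma lie_algebra_complexified:
  assumes "lie_algebra (*\<^sub>R) br"
  shows "lie_algebra cscale (cbracket br)"
proof -
  interpret L: lie_algebra "(*\<^sub>R)" br by fact
  have neg: "br (- x) y = - br x y" "br x (- y) = - br x y" for x y
    using L.bracket_scale_left[of "-1" x y] L.bracket_scale_right[of x "-1" y] by simp_all
  have anti: "br x y = - br y x" for x y
  proof -
    have "0 = br x x + br x y + (br y x + br y y)"
      using L.bracket_alternating[of "x + y"]
      by (simp only: L.bracket_add_left L.bracket_add_right ac_simps)
    then have "br x y + br y x = 0"
      by (simp add: L.bracket_alternating)
    then show ?thesis by (simp add: eq_neg_iff_add_eq_0)
  qed
  have diff: "br (x - y) z = br x z - br y z" "br x (y - z) = br x y - br x z" for x y z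
    using L.bracket_add_left[of x "-y" z] L.bracket_add_right[of x y "-z"] by (simp_all add: neg)
  note lin = L.bracket_add_left L.bracket_add_right L.bracket_scale_left L.bracket_scale_right diff neg
  show ?thesis
  proof
    fix X Y Z :: "'a complexified"
    obtain x1 x2 y1 y2 z1 z2 where P: "X = (x1, x2)" "Y = (y1, y2)" "Z = (z1, z2)"
      by (metis surj_pair)
    have J: "br x (br y z) = - br y (br z x) - br z (br x y)" for x y z
    proof -
      have "br x (br y z) = (br x (br y z) + br y (br z x) + br z (br x y)) - br y (br z x) - br z (br x y)"
        by simp
      then show ?thesis by (simp only: L.jacobi diff_0)
    qed
    show "cbracket br X (cbracket br Y Z) + cbracket br Y (cbracket br Z X) + cbracket br Z (cbracket br X Y) = 0"
      unfolding P cbracket_def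
      by (simp add: lin J[of x1 y1 z1] J[of x1 y2 z2] J[of x2 y1 z2] J[of x2 y2 z1]
          J[of x1 y1 z2] J[of x1 y2 z1] J[of x2 y1 z1] J[of x2 y2 z2] zero_prod_def)
    show "cbracket br X X = 0"
      unfolding P cbracket_def using anti[of x1 x2] by (simp add: L.bracket_alternating zero_prod_def)
  qed (auto simp: cscale_def cbracket_def lin algebra_simps prod_eq_iff)
qed

section \<open>The adjoint action and calculus on the plane\<close>

text \<open>Ad of exp X acts on the complexified Lie algebra as exp (ad X).\<close>
definition Ad_exp :: "('g::euclidean_space \<Rightarrow> 'g \<Rightarrow> 'g) \<Rightarrow> 'g complexified \<Rightarrow> 'g complexified \<Rightarrow> 'g complexified" where
  "Ad_exp br X Y = (\<Sum>n. (1 / fact n) *\<^sub>R ((cbracket br X ^^ n) Y))"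

text \<open>\<^term>\<open>dir_deriv f v z\<close> is the derivative of f at z, in the real sense, in direction v.\<close>
definition dir_deriv :: "(complex \<Rightarrow> 'b::real_normed_vector) \<Rightarrow> complex \<Rightarrow> complex \<Rightarrow> 'b" where
  "dir_deriv f v z = frechet_derivative f (at z) v"

primrec k_times_cont_diff :: "nat \<Rightarrow> (complex \<Rightarrow> 'b::real_normed_vector) \<Rightarrow> bool" where
  "k_times_cont_diff 0 f \<longleftrightarrow> continuous_on UNIV f"
| "k_times_cont_diff (Suc n) f \<longleftrightarrow>
     (\<forall>z. f differentiable at z) \<and> (\<forall>v. k_times_cont_diff n (dir_deriv f v))"

definition smooth :: "(complex \<Rightarrow> 'b::real_normed_vector) \<Rightarrow> bool" where
  "smooth f \<longleftrightarrow> (\<forall>n. k_times_cont_diff n f)"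

definition d_z :: "(complex \<Rightarrow> 'g::euclidean_space complexified) \<Rightarrow> complex \<Rightarrow> 'g complexified" where
  "d_z f z = (1/2) *\<^sub>R (dir_deriv f 1 z - cscale \<i> (dir_deriv f \<i> z))"

definition d_zbar :: "(complex \<Rightarrow> 'g::euclidean_space complexified) \<Rightarrow> complex \<Rightarrow> 'g complexified" where
  "d_zbar f z = (1/2) *\<^sub>R (dir_deriv f 1 z + cscale \<i> (dir_deriv f \<i> z))"

section \<open>The affine Toda setting\<close>

definition coxeter_aut ::
    "('g::euclidean_space \<Rightarrow> 'g \<Rightarrow> 'g) \<Rightarrow> nat \<Rightarrow> nat \<Rightarrow> (nat \<Rightarrow> 'g complexified) \<Rightarrow> 'g complexified \<Rightarrow> 'g complexified" where
  "coxeter_aut br N k \<eta> = Ad_exp br (cscale (2 * of_real pi * \<i> / of_nat k) (\<Sum>j=1..N. \<eta> j))"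

text \<open>
  \<^term>\<open>\<alpha> 0\<close> is the lowest root and \<^term>\<open>\<alpha> 1\<close>, ..., \<^term>\<open>\<alpha> N\<close> are the simple roots. The
  permutation \<^term>\<open>\<pi>\<close> is determined by the other data.
\<close>
locale coxeter_setting =
  fixes br :: "'g::euclidean_space \<Rightarrow> 'g \<Rightarrow> 'g"
    and t :: "'g set"
    and N :: nat
    and \<alpha> :: "nat \<Rightarrow> 'g complexified \<Rightarrow> complex"
    and \<eta> :: "nat \<Rightarrow> 'g complexified"
    and k :: nat
    and \<pi> :: "nat \<Rightarrow> nat"
  assumes lie: "lie_algebra (*\<^sub>R) br"
    and simple: "lie_algebra.simple_lie (*\<^sub>R) br"
    and simple_complexified: "lie_algebra.simple_lie cscale (cbracket br)"
    and cartan_real: "subspace t"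
    and cartan: "lie_algebra.cartan_subalgebra cscale (cbracket br) (complexify t)"
    and simple_roots: "lie_algebra.simple_system cscale (cbracket br) (complexify t) N \<alpha>"
    and dual: "lie_algebra.dual_basis cscale (complexify t) N \<alpha> \<eta>"
    and lowest: "lie_algebra.lowest_root cscale (cbracket br) (complexify t) N \<alpha> (\<alpha> 0)"
    and max_height:
      "int k - 1 \<in> lie_algebra.root_heights cscale (cbracket br) (complexify t) N \<alpha>"
      "\<forall>n\<in>lie_algebra.root_heights cscale (cbracket br) (complexify t) N \<alpha>. n \<le> int k - 1"
    and k_gt_2: "k > 2"
    and preserves_real_form: "coxeter_aut br N k \<eta> ` real_form = real_form"
    and perm: "bij_betw \<pi> {0..N} {0..N}"
    and conj_roots: "\<forall>j\<in>{0..N}. \<forall>X. cnj (\<alpha> j (cconj X)) = - \<alpha> (\<pi> j) X"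

definition cyclic_element ::
    "('g::euclidean_space \<Rightarrow> 'g \<Rightarrow> 'g) \<Rightarrow> 'g set \<Rightarrow> nat \<Rightarrow> (nat \<Rightarrow> 'g complexified \<Rightarrow> complex) \<Rightarrow>
     (nat \<Rightarrow> 'g complexified) \<Rightarrow> nat \<Rightarrow> 'g complexified \<Rightarrow> bool" where
  "cyclic_element br t N \<alpha> \<eta> k W \<longleftrightarrow>
     coxeter_aut br N k \<eta> W = cscale (exp (2 * of_real pi * \<i> / of_nat k)) W \<and>
     (\<exists>w. (\<forall>j\<in>{0..N}. w j \<in> lie_algebra.root_space cscale (cbracket br) (complexify t) (\<alpha> j) \<and> w j \<noteq> 0) \<and>
          W = (\<Sum>j=0..N. w j))"

text \<open>
  One-forms on the plane are functions of a point z and a tangent vector v; dz and its conjugate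
  send v to v and to cnj v. The Maurer-Cartan equation is
  d\<omega> (u, v) + [\<omega> u, \<omega> v] = 0, with constant vector fields u and v.
\<close>
definition toda_form ::
    "('g::euclidean_space \<Rightarrow> 'g \<Rightarrow> 'g) \<Rightarrow> 'g complexified \<Rightarrow> (complex \<Rightarrow> 'g complexified) \<Rightarrow>
     complex \<Rightarrow> complex \<Rightarrow> 'g complexified" where
  "toda_form br W \<Omega> z v =
     cscale v (d_z \<Omega> z + Ad_exp br (\<Omega> z) W) +
     cscale (cnj v) (- d_zbar \<Omega> z + Ad_exp br (- \<Omega> z) (cconj W))"

definition maurer_cartan ::
    "('g::euclidean_space \<Rightarrow> 'g \<Rightarrow> 'g) \<Rightarrow> (complex \<Rightarrow> complex \<Rightarrow> 'g complexified) \<Rightarrow> bool" where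
  "maurer_cartan br \<omega> \<longleftrightarrow>
     (\<forall>z u v. dir_deriv (\<lambda>x. \<omega> x v) u z - dir_deriv (\<lambda>x. \<omega> x u) v z + cbracket br (\<omega> z u) (\<omega> z v) = 0)"

definition integrability_condition ::
    "('g::euclidean_space \<Rightarrow> 'g \<Rightarrow> 'g) \<Rightarrow> 'g complexified \<Rightarrow> (complex \<Rightarrow> 'g complexified) \<Rightarrow> bool" where
  "integrability_condition br W \<Omega> \<longleftrightarrow> maurer_cartan br (toda_form br W \<Omega>)"

text \<open>
  For W the sum of the \<^term>\<open>r j\<close> R(\<^term>\<open>j\<close>), with root vectors R(j), R'(j) for the roots
  \<^term>\<open>\<alpha> j\<close> and their negatives such that R(j) has conjugate R'(\<^term>\<open>\<pi> j\<close>), the coefficient of R'(j) in the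
  conjugate of W is \<^term>\<open>cnj (r (\<pi> j))\<close>, and [R(j), R'(j)] is killing(R(j), R'(j)) times the sharp of
  \<^term>\<open>\<alpha> j\<close>. The coefficients belonging to W are therefore
  \<^term>\<open>m j\<close> = \<^term>\<open>r j * cnj (r (\<pi> j))\<close> * killing(R(j), R'(j)). They reduce to \<^term>\<open>r j * cnj (r j)\<close>
  when \<^term>\<open>r (\<pi> j) = r j\<close> and killing(R(j), R'(j)) = 1, but not in general: for compact real forms the
  Killing factor is negative.
\<close>
definition affine_toda ::
    "('g::euclidean_space \<Rightarrow> 'g \<Rightarrow> 'g) \<Rightarrow> 'g set \<Rightarrow> nat \<Rightarrow> (nat \<Rightarrow> 'g complexified \<Rightarrow> complex) \<Rightarrow>
     (nat \<Rightarrow> complex) \<Rightarrow> (complex \<Rightarrow> 'g complexified) \<Rightarrow> bool" where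
  "affine_toda br t N \<alpha> m \<Omega> \<longleftrightarrow>
     (\<forall>z. 2 *\<^sub>R d_zbar (d_z \<Omega>) z =
        (\<Sum>j=0..N. cscale (m j * exp (2 * \<alpha> j (\<Omega> z)))
           (lie_algebra.killing_sharp cscale (cbracket br) (complexify t) (\<alpha> j))))"

end

theory Submission
  imports Defs
begin

text \<open>
  Write A and B for the coefficients of dz and of its conjugate in the one-form. Its Maurer-Cartan
  equation says that the curvature \<open>d_z B - d_zbar A + [A, B]\<close> vanishes. Since \<open>\<Omega>\<close> takes values in the abelian
  Cartan subalgebra, differentiating \<open>Ad\<close> of \<open>exp \<Omega>\<close> brings down a bracket with the derivative of \<open>\<Omega>\<close>;
  these terms cancel against the mixed terms of \<open>[A, B]\<close> and what remains is
  \<open>[Ad (exp \<Omega>) W, Ad (exp (- \<Omega>)) (cconj W)]\<close> minus twice the mixed derivative of \<open>\<Omega>\<close>. Differences of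
  distinct affine roots are not roots, so the bracket reduces to the terms [R(j), R'(j)], each a multiple of the
  sharp of \<open>\<alpha> j\<close>. This uses that the Killing form is non-degenerate; by simplicity it is enough
  that it is non-zero.
\<close>

section \<open>Traces and the Killing form\<close>

text \<open>Complex two-forms at a point of the plane form a one-dimensional space, so the
  Maurer-Cartan equation is a single Lie algebra equation at each point, and the equivalence holds
  point by point. The factor 2 on the left of the Toda equation arises because the two coefficients
  contribute the mixed derivatives of \<open>\<Omega>\<close> in opposite orders; hence the proof
  that mixed partials agree. The 2 in the exponent arises because \<open>Rp j\<close> and
  \<open>Rm j\<close> have opposite weights and are moved by opposite elements, so both gain the
  same exponential. The sharp is a definite description: non-degeneracy on the Cartan subalgebra
  gives uniqueness, and the bracket of a root vector with an opposite one of non-zero Killing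
  pairing gives existence. Differences of affine roots are excluded by linear independence of the
  simple roots: a natural number plus 1 would have to be 0.\<close>

locale finite_dim_lie_algebra = lie_algebra scale bracket
  for scale :: "'k::field \<Rightarrow> 'v::ab_group_add \<Rightarrow> 'v" and bracket :: "'v \<Rightarrow> 'v \<Rightarrow> 'v" +
  assumes finite_spanning: "\<exists>F. finite F \<and> span F = UNIV"

section \<open>Bracket rules and weight spaces in any dimension\<close>

context lie_algebra
begin

lemma linear_bracket: "Vector_Spaces.linear scale scale (bracket x)"
  by (intro Vector_Spaces.linear_iff[THEN iffD2] conjI allI vector_space_axioms)
    (auto simp: bracket_add_right bracket_scale_right)

lemma linear_bracket_left: "Vector_Spaces.linear scale scale (\<lambda>x. bracket x y)"
  by (intro Vector_Spaces.linear_iff[THEN iffD2] conjI allI vector_space_axioms)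
    (auto simp: bracket_add_left bracket_scale_left)

lemma bracket_zero_right [simp]: "bracket x 0 = 0"
  and bracket_neg_right: "bracket x (- y) = - bracket x y"
  and bracket_diff_right: "bracket x (y - z) = bracket x y - bracket x z"
  and bracket_sum_right: "bracket x (sum g S) = (\<Sum>s\<in>S. bracket x (g s))"
proof -
  interpret l: Vector_Spaces.linear scale scale "bracket x" by (rule linear_bracket)
  show "bracket x 0 = 0" "bracket x (- y) = - bracket x y"
    "bracket x (y - z) = bracket x y - bracket x z"
    "bracket x (sum g S) = (\<Sum>s\<in>S. bracket x (g s))"
    by (rule l.zero l.neg l.diff l.sum)+
qed

lemma bracket_zero_left [simp]: "bracket 0 x = 0"
  and bracket_neg_left: "bracket (- y) x = - bracket y x"
  and bracket_diff_left: "bracket (y - z) x = bracket y x - bracket z x"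
  and bracket_sum_left: "bracket (sum g S) x = (\<Sum>s\<in>S. bracket (g s) x)"
proof -
  interpret l: Vector_Spaces.linear scale scale "\<lambda>y. bracket y x" by (rule linear_bracket_left)
  show "bracket 0 x = 0" "bracket (- y) x = - bracket y x"
    "bracket (y - z) x = bracket y x - bracket z x"
    "bracket (sum g S) x = (\<Sum>s\<in>S. bracket (g s) x)"
    by (rule l.zero l.neg l.diff l.sum)+
qed

lemma bracket_anticommute: "bracket x y = - bracket y x"
proof -
  have "0 = bracket x x + bracket x y + (bracket y x + bracket y y)"
    using bracket_alternating[of "x + y"]
    by (simp only: bracket_add_left bracket_add_right ac_simps)
  then show ?thesis
    by (simp add: bracket_alternating eq_neg_iff_add_eq_0)
qed

text \<open>Jacobi in the form that makes ad a representation; it expands nested brackets under a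
  trace.\<close>

lemma bracket_bracket_left: "bracket (bracket x y) z = bracket x (bracket y z) - bracket y (bracket x z)"
proof -
  have "bracket z (bracket x y) = - bracket x (bracket y z) - bracket y (bracket z x)"
    using jacobi[of x y z] by (simp add: eq_neg_iff_add_eq_0 algebra_simps)
  then show ?thesis
    using bracket_anticommute[of "bracket x y" z] bracket_anticommute[of z x]
    by (simp add: bracket_neg_right)
qed

text \<open>Each \<open>bracket H\<close> is a derivation. The weights are arbitrary functions, so
  sums that are not roots are covered as well.\<close>

lemma bracket_root_spaces:
  assumes "x \<in> root_space h a" "y \<in> root_space h b"
  shows "bracket x y \<in> root_space h (\<lambda>H. a H + b H)"
proof -
  have "bracket H (bracket x y) = scale (a H + b H) (bracket x y)" if "H \<in> h" for H
  proof -
    have "bracket H (bracket x y) = bracket (bracket H x) y + bracket x (bracket H y)"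
      using bracket_bracket_left[of H x y] by simp
    then show ?thesis
      using assms that
      by (simp add: root_space_def bracket_scale_left bracket_scale_right scale_left_distrib)
  qed
  then show ?thesis by (simp add: root_space_def)
qed

text \<open>Otherwise \<^term>\<open>h\<close> and \<^term>\<open>x\<close> would span a larger abelian subalgebra.\<close>
lemma root_space_zero_cartan:
  assumes cartan: "cartan_subalgebra h" and x: "x \<in> root_space h a" and a: "\<And>H. H \<in> h \<Longrightarrow> a H = 0"
  shows "x \<in> h"
proof -
  have comm: "bracket H x = 0" if "H \<in> h" for H
    using x a that by (simp add: root_space_def)
  have h: "subspace h" "\<And>y z. y \<in> h \<Longrightarrow> z \<in> h \<Longrightarrow> bracket y z = 0"
    using cartan by (auto simp: cartan_subalgebra_def abelian_subalgebra_def)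
  define h' where "h' = {y + scale c x |y c. y \<in> h}"
  have "abelian_subalgebra h'"
    unfolding abelian_subalgebra_def
  proof (intro conjI ballI)
    show "subspace h'"
    proof (rule subspaceI)
      show "0 \<in> h'"
        unfolding h'_def using subspace_0[OF h(1)] by (auto intro!: exI[of _ 0])
    next
      fix u v assume "u \<in> h'" "v \<in> h'"
      then obtain y c z d where "u = y + scale c x" "v = z + scale d x" "y \<in> h" "z \<in> h"
        unfolding h'_def by blast
      moreover have "y + scale c x + (z + scale d x) = (y + z) + scale (c + d) x"
        by (simp add: scale_left_distrib)
      ultimately show "u + v \<in> h'"
        unfolding h'_def using subspace_add[OF h(1)] by blast
    next
      fix c u assume "u \<in> h'"
      then obtain y d where "u = y + scale d x" "y \<in> h"
        unfolding h'_def by blast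
      then have "scale c u = scale c y + scale (c * d) x" "scale c y \<in> h"
        using subspace_scale[OF h(1)] by (auto simp: scale_right_distrib)
      then show "scale c u \<in> h'"
        unfolding h'_def by blast
    qed
  next
    fix u v assume "u \<in> h'" "v \<in> h'"
    then obtain y c z d where "u = y + scale c x" "v = z + scale d x" "y \<in> h" "z \<in> h"
      unfolding h'_def by blast
    then show "bracket u v = 0"
      using h(2) comm bracket_anticommute[of x z]
      by (simp add: bracket_add_left bracket_add_right bracket_scale_left bracket_scale_right
          bracket_alternating)
  qed
  moreover have "h \<subseteq> h'"
  proof
    fix y assume "y \<in> h"
    moreover have "y = y + scale 0 x" by simp
    ultimately show "y \<in> h'" unfolding h'_def by blast
  qed
  moreover have "x \<in> h'"
    unfolding h'_def using subspace_0[OF h(1)] by (auto intro!: exI[of _ 0] exI[of _ 1])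
  ultimately show ?thesis
    using cartan by (auto simp: cartan_subalgebra_def)
qed

end

context finite_dim_lie_algebra
begin

lemma finite_independent:
  assumes "independent B"
  shows "finite B"
  using finite_spanning assms independent_span_bound by (metis subset_UNIV)

text \<open>\<open>endo_trace\<close> uses a basis picked by choice. After expanding
  \<open>f e\<close> in \<open>B\<close>, the sum over \<open>E\<close> reassembles each vector
  \<open>c\<close> of \<open>B\<close> and leaves a Kronecker delta. This allows a Killing norm to
  be computed in an eigenbasis. Finite dimension matters, as a sum over an infinite basis would be 0
  by default.\<close>

lemma endo_trace_basis:
  assumes B: "independent B" "span B = UNIV" and f: "Vector_Spaces.linear scale scale f"
  shows "endo_trace f = (\<Sum>b\<in>B. representation B (f b) b)"
proof -
  interpret f: Vector_Spaces.linear scale scale f by fact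
  define E where "E = extend_basis {}"
  have E: "independent E" "span E = UNIV"
    unfolding E_def by (rule independent_extend_basis span_extend_basis independent_empty)+
  have fin: "finite B" "finite E"
    using B(1) E(1) finite_independent by auto
  have expB: "(\<Sum>b\<in>B. scale (representation B v b) b) = v" for v
    using sum_representation_eq[OF B(1) _ fin(1)] B by simp
  have expE: "(\<Sum>b\<in>E. scale (representation E v b) b) = v" for v
    using sum_representation_eq[OF E(1) _ fin(2)] E by simp
  interpret rE: Vector_Spaces.linear scale "(*)" "\<lambda>v. representation E v e" for e
    by (rule linear_representation[OF E])
  interpret rB: Vector_Spaces.linear scale "(*)" "\<lambda>v. representation B v e" for e
    by (rule linear_representation[OF B])
  have "representation E (f e) e =
      (\<Sum>b\<in>B. \<Sum>c\<in>B. representation B e b * representation B (f b) c * representation E c e)" for e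
  proof -
    have "f e = (\<Sum>b\<in>B. \<Sum>c\<in>B. scale (representation B e b * representation B (f b) c) c)"
    proof -
      have "f e = f (\<Sum>b\<in>B. scale (representation B e b) b)"
        by (simp only: expB)
      also have "\<dots> = (\<Sum>b\<in>B. scale (representation B e b) (f b))"
        by (simp add: f.sum f.scale)
      also have "\<dots> = (\<Sum>b\<in>B. scale (representation B e b) (\<Sum>c\<in>B. scale (representation B (f b) c) c))"
        by (simp only: expB)
      finally show ?thesis
        by (simp add: scale_sum_right)
    qed
    then have "representation E (f e) e =
        representation E (\<Sum>b\<in>B. \<Sum>c\<in>B. scale (representation B e b * representation B (f b) c) c) e"
      by simp
    then show ?thesis
      by (simp add: rE.sum rE.scale)
  qed
  then have "endo_trace f =
      (\<Sum>e\<in>E. \<Sum>b\<in>B. \<Sum>c\<in>B. representation B e b * representation B (f b) c * representation E c e)"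
    by (simp add: endo_trace_def E_def)
  also have "\<dots> = (\<Sum>b\<in>B. \<Sum>c\<in>B. representation B (f b) c *
      (\<Sum>e\<in>E. representation E c e * representation B e b))"
    by (subst sum.swap, rule sum.cong[OF refl], subst sum.swap)
      (simp add: sum_distrib_left mult_ac)
  also have "\<dots> = (\<Sum>b\<in>B. \<Sum>c\<in>B. representation B (f b) c * (if b = c then 1 else 0))"
  proof (intro sum.cong refl)
    fix b c assume b: "b \<in> B" and c: "c \<in> B"
    have "(\<Sum>e\<in>E. representation E c e * representation B e b) =
        representation B (\<Sum>e\<in>E. scale (representation E c e) e) b"
      by (simp add: rB.sum rB.scale)
    also have "\<dots> = representation B c b"
      by (simp only: expE)
    finally show "representation B (f b) c * (\<Sum>e\<in>E. representation E c e * representation B e b) =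
        representation B (f b) c * (if b = c then 1 else 0)"
      using representation_basis[OF B(1) c] by simp
  qed
  also have "\<dots> = (\<Sum>b\<in>B. representation B (f b) b)"
    using fin by (simp add: if_distrib[where f = "(*) _"] cong: if_cong)
  finally show ?thesis .
qed

lemma endo_trace_commute:
  assumes f: "Vector_Spaces.linear scale scale f" and g: "Vector_Spaces.linear scale scale g"
  shows "endo_trace (\<lambda>x. f (g x)) = endo_trace (\<lambda>x. g (f x))"
proof -
  define E where "E = extend_basis {}"
  have E: "independent E" "span E = UNIV"
    unfolding E_def by (rule independent_extend_basis span_extend_basis independent_empty)+
  have fin: "finite E"
    using E(1) finite_independent by auto
  have expE: "(\<Sum>b\<in>E. scale (representation E v b) b) = v" for v
    using sum_representation_eq[OF E(1) _ fin] E by simp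
  interpret rE: Vector_Spaces.linear scale "(*)" "\<lambda>v. representation E v e" for e
    by (rule linear_representation[OF E])
  have exp: "representation E (f (g e)) e =
      (\<Sum>c\<in>E. representation E (g e) c * representation E (f c) e)"
    if "Vector_Spaces.linear scale scale f" for f g e
  proof -
    interpret f: Vector_Spaces.linear scale scale f by fact
    have "representation E (f (g e)) e =
        representation E (f (\<Sum>c\<in>E. scale (representation E (g e) c) c)) e"
      by (simp only: expE)
    then show ?thesis
      by (simp add: f.sum f.scale rE.sum rE.scale)
  qed
  show ?thesis
    unfolding endo_trace_def E_def[symmetric] exp[OF f, of g] exp[OF g, of f]
    by (subst sum.swap) (simp add: mult.commute)
qed

lemma endo_trace_add: "endo_trace (\<lambda>x. f x + g x) = endo_trace f + endo_trace g"
  and endo_trace_diff: "endo_trace (\<lambda>x. f x - g x) = endo_trace f - endo_trace g"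
  and endo_trace_scale: "endo_trace (\<lambda>x. scale c (f x)) = c * endo_trace f"
proof -
  define E where "E = extend_basis {}"
  have E: "independent E" "span E = UNIV"
    unfolding E_def by (rule independent_extend_basis span_extend_basis independent_empty)+
  interpret rE: Vector_Spaces.linear scale "(*)" "\<lambda>v. representation E v e" for e
    by (rule linear_representation[OF E])
  show "endo_trace (\<lambda>x. f x + g x) = endo_trace f + endo_trace g"
    "endo_trace (\<lambda>x. f x - g x) = endo_trace f - endo_trace g"
    "endo_trace (\<lambda>x. scale c (f x)) = c * endo_trace f"
    unfolding endo_trace_def E_def[symmetric]
    by (simp_all add: rE.add rE.diff rE.scale sum.distrib sum_subtractf sum_distrib_left)
qed

lemma linear_bracket_bracket: "Vector_Spaces.linear scale scale (\<lambda>z. bracket x (bracket y z))"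
  by (intro Vector_Spaces.linear_iff[THEN iffD2] conjI allI vector_space_axioms)
    (auto simp: bracket_add_right bracket_scale_right)

lemma killing_commute: "killing x y = killing y x"
  unfolding killing_def by (rule endo_trace_commute[OF linear_bracket linear_bracket])

lemma linear_killing: "Vector_Spaces.linear scale (*) (killing x)"
  by (intro Vector_Spaces.linear_iff[THEN iffD2] conjI allI vector_space_axioms)
    (auto simp: killing_def bracket_add_left bracket_add_right bracket_scale_left bracket_scale_right
      endo_trace_add endo_trace_scale distrib_left vector_space_over_itself.vector_space_axioms)

lemma killing_zero_right [simp]: "killing x 0 = 0"
  and killing_scale_right: "killing x (scale c y) = c * killing x y"
  and killing_add_right: "killing x (y + z) = killing x y + killing x z"
  and killing_diff_right: "killing x (y - z) = killing x y - killing x z"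
proof -
  interpret l: Vector_Spaces.linear scale "(*)" "killing x" by (rule linear_killing)
  show "killing x 0 = 0" "killing x (scale c y) = c * killing x y"
    "killing x (y + z) = killing x y + killing x z"
    "killing x (y - z) = killing x y - killing x z"
    by (rule l.zero l.scale l.add l.diff)+
qed

lemma killing_scale_left: "killing (scale c x) y = c * killing x y"
  and killing_diff_left: "killing (x - z) y = killing x y - killing z y"
  using killing_scale_right[of y c x] killing_diff_right[of y x z]
  by (simp_all only: killing_commute[of y])

text \<open>Both sides contain the trace of \<open>xyz\<close> (in the adjoint representation); the
  remaining terms, the traces of \<open>yxz\<close> and \<open>xzy\<close>, agree by
  cyclicity.\<close>

lemma killing_invariant: "killing (bracket x y) z = killing x (bracket y z)"
proof -
  have "killing (bracket x y) z =
      endo_trace (\<lambda>v. bracket x (bracket y (bracket z v))) - endo_trace (\<lambda>v. bracket y (bracket x (bracket z v)))"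
    by (simp add: killing_def bracket_bracket_left endo_trace_diff)
  also have "endo_trace (\<lambda>v. bracket y (bracket x (bracket z v))) =
      endo_trace (\<lambda>v. bracket x (bracket z (bracket y v)))"
    by (rule endo_trace_commute[OF linear_bracket linear_bracket_bracket])
  finally show ?thesis
    by (simp add: killing_def bracket_bracket_left bracket_diff_right endo_trace_diff)
qed

text \<open>Invariance makes \<open>bracket H\<close> skew for the Killing form, so the pairing is
  annihilated by \<open>a H + b H\<close>.\<close>

lemma killing_root_spaces_orthogonal:
  assumes x: "x \<in> root_space h a" and y: "y \<in> root_space h b" and H: "H \<in> h" "a H + b H \<noteq> 0"
  shows "killing x y = 0"
proof -
  have "a H * killing x y = killing y (bracket H x)"
    using x H by (simp add: root_space_def killing_scale_right killing_commute[of x])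
  also have "\<dots> = - killing x (bracket H y)"
  proof -
    have "killing y (bracket H x) = killing (bracket y H) x"
      by (simp add: killing_invariant)
    also have "\<dots> = killing x (- bracket H y)"
      using bracket_anticommute[of y H] by (simp add: killing_commute)
    also have "\<dots> = - killing x (bracket H y)"
      using killing_diff_right[of x 0 "bracket H y"] by simp
    finally show ?thesis .
  qed
  also have "\<dots> = - b H * killing x y"
    using y H by (simp add: root_space_def killing_scale_right)
  finally have "(a H + b H) * killing x y = 0"
    by (simp add: distrib_right)
  then show ?thesis using H by simp
qed

text \<open>By invariance the radical is an ideal; \<open>v\<close> lies outside it, so simplicity
  leaves only zero.\<close>

lemma killing_nondegenerate:
  assumes simple: "simple_lie" and nz: "killing u v \<noteq> 0" and x: "\<And>y. killing x y = 0"
  shows "x = 0"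
proof -
  define I where "I = {x. \<forall>y. killing y x = 0}"
  have "lie_ideal I"
    unfolding lie_ideal_def
  proof (intro conjI allI ballI)
    show "subspace I"
      by (rule subspaceI) (auto simp: I_def killing_add_right killing_scale_right)
    show "bracket y z \<in> I" if "z \<in> I" for y z
      using that killing_invariant[of _ y z] by (simp add: I_def)
  qed
  moreover have "v \<notin> I"
    using nz by (auto simp: I_def)
  ultimately have "I = {0}"
    using simple by (auto simp: simple_lie_def)
  moreover have "x \<in> I"
    using x by (simp add: I_def killing_commute)
  ultimately show ?thesis by simp
qed

section \<open>Weight decomposition\<close>

text \<open>Applying \<open>f\<close> minus the scalar \<open>m\<close> removes the component at
  \<open>m\<close> and rescales every other one by \<open>c - m\<close>, which is non-zero. The
  induction hypothesis is used for the rescaled components, hence the arbitrary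
  \<open>y\<close>.\<close>

lemma eigencomponents_in_invariant_subspace:
  assumes f: "Vector_Spaces.linear scale scale f" and V: "subspace V" "\<And>v. v \<in> V \<Longrightarrow> f v \<in> V"
    and "finite \<Lambda>" "\<And>c. c \<in> \<Lambda> \<Longrightarrow> f (y c) = scale c (y c)" "(\<Sum>c\<in>\<Lambda>. y c) \<in> V"
  shows "\<forall>c\<in>\<Lambda>. y c \<in> V"
  using assms(4-6)
proof (induction \<Lambda> arbitrary: y rule: finite_induct)
  case (insert m \<Lambda>)
  interpret f: Vector_Spaces.linear scale scale f by fact
  let ?x = "\<Sum>c\<in>insert m \<Lambda>. y c"
  have "f ?x - scale m ?x = (\<Sum>c\<in>\<Lambda>. scale (c - m) (y c))"
    using insert.hyps insert.prems(1)
    by (simp add: f.sum f.add scale_right_distrib scale_sum_right scale_left_diff_distrib sum_subtractf)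
  moreover have "f ?x - scale m ?x \<in> V"
    using insert.prems(2) V by (blast intro: subspace_diff subspace_scale)
  ultimately have "\<forall>c\<in>\<Lambda>. scale (c - m) (y c) \<in> V"
    using insert.prems(1) by (intro insert.IH) (auto simp: f.scale scale_left_commute)
  then have IH: "y c \<in> V" if "c \<in> \<Lambda>" for c
  proof -
    have "scale (inverse (c - m)) (scale (c - m) (y c)) \<in> V"
      using \<open>\<forall>c\<in>\<Lambda>. scale (c - m) (y c) \<in> V\<close> that V by (blast intro: subspace_scale)
    moreover have "c \<noteq> m" using that insert.hyps by auto
    ultimately show ?thesis by simp
  qed
  have "y m = ?x - (\<Sum>c\<in>\<Lambda>. y c)"
    using insert.hyps by simp
  also have "\<dots> \<in> V"
    using insert.prems(2) IH V by (blast intro: subspace_diff subspace_sum)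
  finally show ?case using IH by blast
qed simp

text \<open>Terms of the eigenbasis expansion with equal eigenvalue are collected, so that the
  components are indexed by distinct scalars, as the preceding lemma requires.\<close>

lemma diagonalizable_eigencomponents:
  assumes "diagonalizable_endo f" and f: "Vector_Spaces.linear scale scale f"
  obtains \<Lambda> y where "finite \<Lambda>" "\<And>c. c \<in> \<Lambda> \<Longrightarrow> f (y c) = scale c (y c)" "x = (\<Sum>c\<in>\<Lambda>. y c)"
proof -
  interpret f: Vector_Spaces.linear scale scale f by fact
  obtain B where B: "independent B" "span B = UNIV" "\<forall>b\<in>B. \<exists>c. f b = scale c b"
    using assms(1) unfolding diagonalizable_endo_def by blast
  then obtain e where e: "\<And>b. b \<in> B \<Longrightarrow> f b = scale (e b) b"
    by metis
  have fin: "finite B" using B(1) finite_independent by blast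
  let ?u = "\<lambda>b. scale (representation B x b) b"
  let ?y = "\<lambda>c. sum ?u {b \<in> B. e b = c}"
  have "x = (\<Sum>b\<in>B. ?u b)"
    using sum_representation_eq[OF B(1) _ fin] B by simp
  also have "\<dots> = (\<Sum>c\<in>e ` B. ?y c)"
    by (rule sum.image_gen[OF fin])
  finally have "x = (\<Sum>c\<in>e ` B. ?y c)" .
  moreover have "f (?y c) = scale c (?y c)" for c
    unfolding f.sum scale_sum_right by (intro sum.cong refl) (auto simp: f.scale e mult.commute)
  ultimately show thesis
    using that[of "e ` B" ?y] fin by blast
qed

text \<open>Simultaneous diagonalization, one element at a time: \<open>G\<close> commutes with
  \<open>S\<close>, so it preserves the joint eigenspace \<open>V\<close> of \<open>x\<close>, and
  the \<open>G\<close>-eigencomponents of \<open>x\<close> stay in \<open>V\<close>.\<close>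

lemma span_common_eigenvectors:
  assumes S: "finite S" "S \<subseteq> h" and h: "cartan_subalgebra h"
  shows "span {x. \<forall>H\<in>S. \<exists>c. bracket H x = scale c x} = UNIV"
  using S
proof (induction S rule: finite_induct)
  case (insert G S)
  let ?E = "\<lambda>S. {x. \<forall>H\<in>S. \<exists>c. bracket H x = scale c x}"
  have "x \<in> span (?E (insert G S))" if x: "x \<in> ?E S" for x
  proof -
    obtain a where a: "\<And>H. H \<in> S \<Longrightarrow> bracket H x = scale (a H) x"
      using bchoice[of S "\<lambda>H c. bracket H x = scale c x"] x by blast
    define V where "V = {v. \<forall>H\<in>S. bracket H v = scale (a H) v}"
    have V: "subspace V"
      unfolding V_def
      by (rule subspaceI) (auto simp: bracket_add_right scale_right_distrib bracket_scale_right scale_left_commute)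
    have inv: "bracket G v \<in> V" if "v \<in> V" for v
    proof -
      have "bracket H (bracket G v) = scale (a H) (bracket G v)" if "H \<in> S" for H
      proof -
        have "bracket H G = 0"
          using that insert.prems h by (auto simp: cartan_subalgebra_def abelian_subalgebra_def)
        then have "bracket H (bracket G v) = bracket G (bracket H v)"
          using bracket_bracket_left[of H G v] by simp
        then show ?thesis
          using \<open>v \<in> V\<close> that by (simp add: V_def bracket_scale_right)
      qed
      then show ?thesis by (simp add: V_def)
    qed
    have "diagonalizable_endo (bracket G)"
      using h insert.prems by (auto simp: cartan_subalgebra_def)
    then obtain \<Lambda> y where y: "finite \<Lambda>" "\<And>c. c \<in> \<Lambda> \<Longrightarrow> bracket G (y c) = scale c (y c)" "x = (\<Sum>c\<in>\<Lambda>. y c)"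
      using diagonalizable_eigencomponents[OF _ linear_bracket, of G x] by metis
    have "x \<in> V" using a by (simp add: V_def)
    then have "\<forall>c\<in>\<Lambda>. y c \<in> V"
      using y by (intro eigencomponents_in_invariant_subspace[OF linear_bracket V inv]) auto
    then have "\<forall>c\<in>\<Lambda>. y c \<in> ?E (insert G S)"
      using y(2) by (auto simp: V_def)
    then show ?thesis
      unfolding y(3) by (blast intro: span_sum span_base)
  qed
  then have "?E S \<subseteq> span (?E (insert G S))" by blast
  then have "span (?E S) \<subseteq> span (?E (insert G S))"
    by (rule span_minimal) (rule subspace_span)
  then show ?case
    using insert by auto
qed simp

lemma span_root_spaces:
  assumes h: "cartan_subalgebra h"
  shows "span (\<Union>a. root_space h a) = UNIV"
proof -
  \<comment> \<open>The simultaneous diagonalization is by induction over a finite set, so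
    \<open>h\<close> is replaced by a basis; being a common eigenvector then extends to
    \<open>h\<close> by linearity.\<close>
  obtain S where S: "S \<subseteq> h" "independent S" "h \<subseteq> span S"
    by (rule maximal_independent_subset)
  have "x \<in> (\<Union>a. root_space h a)" if x: "\<forall>H\<in>S. \<exists>c. bracket H x = scale c x" for x
  proof -
    have "\<exists>c. bracket H x = scale c x" if "H \<in> h" for H
    proof -
      have "H \<in> span S" using S that by blast
      then show ?thesis
      proof (induction rule: span_induct_alt)
        case base
        then show ?case by (auto intro!: exI[of _ 0])
      next
        case (step c y z)
        then obtain d e where "bracket y x = scale d x" "bracket z x = scale e x"
          using x by blast
        then have "bracket (scale c y + z) x = scale (c * d + e) x"
          by (simp add: bracket_add_left bracket_scale_left scale_left_distrib)
        then show ?case by blast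
      qed
    qed
    then obtain a where "\<And>H. H \<in> h \<Longrightarrow> bracket H x = scale (a H) x"
      by metis
    then show ?thesis by (auto simp: root_space_def)
  qed
  then have "{x. \<forall>H\<in>S. \<exists>c. bracket H x = scale c x} \<subseteq> (\<Union>a. root_space h a)"
    by blast
  then show ?thesis
    using span_mono span_common_eigenvectors[OF finite_independent[OF S(2)] S(1) h] by blast
qed

section \<open>Non-degeneracy on the Cartan subalgebra and the sharp of a root\<close>

lemma killing_detected_by_root_space:
  assumes h: "cartan_subalgebra h" and nz: "killing x y \<noteq> 0"
  obtains a z where "z \<in> root_space h a" "killing x z \<noteq> 0"
proof -
  have "\<exists>z\<in>(\<Union>a. root_space h a). killing x z \<noteq> 0"
  proof (rule ccontr)
    assume "\<not> ?thesis"
    then have "\<And>z. z \<in> (\<Union>a. root_space h a) \<Longrightarrow> killing x z = 0" by blast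
    moreover have "subspace {z. killing x z = 0}"
      by (rule subspaceI) (auto simp: killing_add_right killing_scale_right)
    ultimately have "span (\<Union>a. root_space h a) \<subseteq> {z. killing x z = 0}"
      by (intro span_minimal) blast+
    then show False using nz span_root_spaces[OF h] by blast
  qed
  then show thesis using that by blast
qed

text \<open>\<open>H\<close> has weight zero and so pairs only with vectors of weight zero, which
  all lie in \<open>h\<close> by maximality.\<close>

lemma killing_nondegenerate_cartan:
  assumes simple: "simple_lie" and nz: "killing u v \<noteq> 0" and h: "cartan_subalgebra h"
    and H: "H \<in> h" "\<And>H'. H' \<in> h \<Longrightarrow> killing H H' = 0"
  shows "H = 0"
proof (rule killing_nondegenerate[OF simple nz])
  fix y show "killing H y = 0"
  proof (rule ccontr)
    assume "killing H y \<noteq> 0"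
    then obtain a z where z: "z \<in> root_space h a" "killing H z \<noteq> 0"
      using killing_detected_by_root_space[OF h] by metis
    have "H \<in> root_space h (\<lambda>_. 0)"
      using h H(1) by (auto simp: root_space_def cartan_subalgebra_def abelian_subalgebra_def)
    then have "a G = 0" if "G \<in> h" for G
      using killing_root_spaces_orthogonal[of H h "\<lambda>_. 0" z a G] z that by auto
    then have "z \<in> h"
      using root_space_zero_cartan[OF h z(1)] by blast
    then show False using H(2) z(2) by blast
  qed
qed

text \<open>Non-degeneracy supplies some weight vector pairing with \<open>x\<close>; orthogonality
  forces its weight to be \<open>- a\<close> on \<open>h\<close>.\<close>

lemma opposite_root_vector:
  assumes simple: "simple_lie" and nz: "killing u v \<noteq> 0" and h: "cartan_subalgebra h"
    and x: "x \<in> root_space h a" "x \<noteq> 0"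
  obtains y where "y \<in> root_space h (\<lambda>H. - a H)" "killing x y \<noteq> 0"
proof -
  obtain y' where "killing x y' \<noteq> 0"
    using killing_nondegenerate[OF simple nz] x(2) by blast
  then obtain b y where y: "y \<in> root_space h b" "killing x y \<noteq> 0"
    using killing_detected_by_root_space[OF h] by metis
  have "b H = - a H" if "H \<in> h" for H
    using killing_root_spaces_orthogonal[OF x(1) y(1) that] y(2) by (auto simp: eq_neg_iff_add_eq_0 add.commute)
  then have "y \<in> root_space h (\<lambda>H. - a H)"
    using y(1) by (simp add: root_space_def)
  then show thesis using that y(2) by blast
qed

lemma bracket_opposite_root_vectors:
  assumes h: "cartan_subalgebra h"
    and x: "x \<in> root_space h a" and y: "y \<in> root_space h (\<lambda>H. - a H)"
  shows "bracket x y \<in> h" and "H \<in> h \<Longrightarrow> killing (bracket x y) H = killing x y * a H"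
proof -
  show "bracket x y \<in> h"
    by (rule root_space_zero_cartan[OF h bracket_root_spaces[OF x y]]) simp
  assume H: "H \<in> h"
  have "bracket y H = scale (a H) y"
    using y H bracket_anticommute[of y H] by (simp add: root_space_def)
  then show "killing (bracket x y) H = killing x y * a H"
    by (simp add: killing_invariant killing_scale_right mult.commute)
qed

lemma bracket_opposite_root_vectors_sharp:
  assumes simple: "simple_lie" and nz: "killing u v \<noteq> 0" and h: "cartan_subalgebra h"
    and x: "x \<in> root_space h a" and y: "y \<in> root_space h (\<lambda>H. - a H)"
    and ex: "\<exists>w\<in>root_space h a. w \<noteq> 0"
  shows "bracket x y = scale (killing x y) (killing_sharp h a)"
proof -
  have sub: "subspace h"
    using h by (simp add: cartan_subalgebra_def abelian_subalgebra_def)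
  note inj = killing_nondegenerate_cartan[OF simple nz h]
  have eqI: "H = K" if "H \<in> h" "K \<in> h" "\<And>H'. H' \<in> h \<Longrightarrow> killing H H' = killing K H'" for H K
  proof -
    have "H - K = 0"
      using that by (intro inj subspace_diff[OF sub])
        (simp_all add: killing_diff_left)
    then show ?thesis by simp
  qed
  let ?P = "\<lambda>H. H \<in> h \<and> (\<forall>H'\<in>h. killing H H' = a H')"
  \<comment> \<open>\<open>killing x y\<close> may vanish, so existence of the sharp is shown with
    another pair, whose bracket can be normalised.\<close>
  obtain w w' where w: "w \<in> root_space h a" "w' \<in> root_space h (\<lambda>H. - a H)" "killing w w' \<noteq> 0"
    using ex opposite_root_vector[OF simple nz h] by metis
  have "?P (scale (inverse (killing w w')) (bracket w w'))"
    using bracket_opposite_root_vectors[OF h w(1,2)] w(3) subspace_scale[OF sub]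
    by (auto simp: killing_scale_left)
  then have "\<exists>!H. ?P H"
    using eqI by (intro ex1I[of ?P]) auto
  then have sharp: "?P (killing_sharp h a)"
    unfolding killing_sharp_def by (rule theI')
  show ?thesis
    using bracket_opposite_root_vectors[OF h x y] sharp subspace_scale[OF sub]
    by (intro eqI) (auto simp: killing_scale_left)
qed

end

section \<open>The complexified Lie algebra\<close>

lemma scaleR_eq_cscale: "c *\<^sub>R X = cscale (of_real c) X"
  by (simp add: cscale_def prod_eq_iff)

lemma finite_dim_lie_algebra_complexified:
  fixes br :: "'g::euclidean_space \<Rightarrow> 'g \<Rightarrow> 'g"
  assumes "lie_algebra (*\<^sub>R) br"
  shows "finite_dim_lie_algebra cscale (cbracket br)"
proof -
  interpret lie_algebra cscale "cbracket br"
    by (rule lie_algebra_complexified[OF assms])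
  have "X \<in> span ((\<lambda>b. (b, 0)) ` Basis)" for X :: "'g complexified"
  proof -
    have "X = (\<Sum>b\<in>Basis. cscale (Complex (fst X \<bullet> b) (snd X \<bullet> b)) (b, 0))"
      by (simp add: prod_eq_iff cscale_def fst_sum snd_sum euclidean_representation)
    also have "\<dots> \<in> span ((\<lambda>b. (b, 0)) ` Basis)"
      by (intro span_sum span_scale span_base) auto
    finally show ?thesis .
  qed
  then show ?thesis
    by unfold_locales (auto intro!: exI[of _ "(\<lambda>b. (b, 0)) ` Basis"])
qed

lemma (in lie_algebra)
  assumes x: "x \<in> root_space h a" "x \<noteq> 0" and h: "subspace h"
  shows root_scale: "H \<in> h \<Longrightarrow> a (scale c H) = c * a H"
    and root_sum: "(\<And>i. i \<in> I \<Longrightarrow> g i \<in> h) \<Longrightarrow> a (sum g I) = (\<Sum>i\<in>I. a (g i))"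
proof -
  have eqI: "c = d" if "scale c x = scale d x" for c d
    using that x(2) by simp
  have ev: "scale (a H) x = bracket H x" if "H \<in> h" for H
    using x(1) that by (simp add: root_space_def)
  show "a (scale c H) = c * a H" if "H \<in> h" for H c
    using that subspace_scale[OF h]
    by (intro eqI) (simp add: ev bracket_scale_left flip: scale_scale)
  show "a (sum g I) = (\<Sum>i\<in>I. a (g i))" if "\<And>i. i \<in> I \<Longrightarrow> g i \<in> h" for g :: "'i \<Rightarrow> _" and I
    using that subspace_sum[OF h, of I g]
    by (intro eqI) (simp add: scale_sum_left ev bracket_sum_left)
qed

context coxeter_setting
begin

sublocale C: finite_dim_lie_algebra cscale "cbracket br"
  by (rule finite_dim_lie_algebra_complexified[OF lie])

abbreviation "\<hh> \<equiv> complexify t"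

lemma subspace_cartan: "C.subspace \<hh>"
  and cartan_commute: "H \<in> \<hh> \<Longrightarrow> K \<in> \<hh> \<Longrightarrow> cbracket br H K = 0"
  using cartan by (auto simp: C.cartan_subalgebra_def C.abelian_subalgebra_def)

lemma affine_root: "j \<in> {0..N} \<Longrightarrow> \<alpha> j \<in> C.roots \<hh>"
  using simple_roots lowest
  by (cases "j = 0") (auto simp: C.simple_system_def C.lowest_root_def)

lemma root_eq_0_outside: "j \<in> {0..N} \<Longrightarrow> H \<notin> \<hh> \<Longrightarrow> \<alpha> j H = 0"
  using affine_root unfolding C.roots_def by blast

lemma simple_root_coeff_zero:
  assumes "\<And>H. H \<in> \<hh> \<Longrightarrow> (\<Sum>i=1..N. c i * \<alpha> i H) = 0" "i \<in> {1..N}"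
  shows "c i = 0"
  using simple_roots assms unfolding C.simple_system_def by blast

text \<open>Without simple roots every height is an empty sum, which would force
  \<open>k = 1\<close>. A simple root is needed below to see that \<open>\<rho>\<close> acts
  non-trivially.\<close>

lemma N_pos: "N \<ge> 1"
proof (rule ccontr)
  assume "\<not> ?thesis"
  then have "N = 0" by simp
  with max_height(1) have "int k - 1 = 0"
    by (auto simp: C.root_heights_def)
  with k_gt_2 show False by simp
qed

text \<open>
  The sum of the \<^term>\<open>\<eta> j\<close> acts on each root space by the height of the root, so its Killing norm is a
  non-trivial sum of squares of integers. This replaces Cartan's criterion.
\<close>
lemma killing_nonzero: "\<exists>u v. C.killing u v \<noteq> 0"
proof -
  define \<rho> where "\<rho> = (\<Sum>j=1..N. \<eta> j)"
  have \<eta>: "\<eta> j \<in> \<hh>" if "j \<in> {1..N}" for j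
    using dual that C.span_base[of "\<eta> j" "\<eta> ` {1..N}"] by (simp add: C.dual_basis_def)
  have \<rho>: "\<rho> \<in> \<hh>"
    unfolding \<rho>_def using \<eta> by (intro C.subspace_sum[OF subspace_cartan]) auto
  have \<alpha>\<rho>: "\<alpha> i \<rho> = 1" if i: "i \<in> {1..N}" for i
  proof -
    obtain x where x: "x \<in> C.root_space \<hh> (\<alpha> i)" "x \<noteq> 0"
      using affine_root[of i] i by (auto simp: C.roots_def)
    have "\<alpha> i \<rho> = (\<Sum>j=1..N. \<alpha> i (\<eta> j))"
      unfolding \<rho>_def by (rule C.root_sum[OF x subspace_cartan \<eta>])
    also have "\<dots> = (\<Sum>j=1..N. if i = j then 1 else 0)"
      using dual i by (intro sum.cong) (auto simp: C.dual_basis_def)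
    also have "\<dots> = 1" using i by simp
    finally show ?thesis .
  qed
  obtain B where B: "B \<subseteq> (\<Union>a. C.root_space \<hh> a)" "C.independent B"
      "(\<Union>a. C.root_space \<hh> a) \<subseteq> C.span B"
    by (rule C.maximal_independent_subset)
  have spanB: "C.span B = UNIV"
    using C.span_minimal[OF B(3) C.subspace_span] C.span_root_spaces[OF cartan] by blast
  have finB: "finite B" using C.finite_independent[OF B(2)] .
  have "\<exists>n. cbracket br \<rho> b = cscale (of_int n) b" if b: "b \<in> B" for b
  proof -
    obtain a where a: "b \<in> C.root_space \<hh> a" using B b by blast
    have b0: "b \<noteq> 0" using B(2) b C.dependent_zero by blast
    \<comment> \<open>Members of \<open>roots\<close> vanish outside the Cartan subalgebra by
      convention, so the weight is cut off before it can be recognised as a root.\<close>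
    define a' where "a' = (\<lambda>H. if H \<in> \<hh> then a H else 0)"
    have a': "b \<in> C.root_space \<hh> a'"
      using a by (simp add: C.root_space_def a'_def)
    have "\<exists>n. a' \<rho> = of_int n"
    proof (cases "\<exists>H\<in>\<hh>. a' H \<noteq> 0")
      case False
      then have "a' \<rho> = of_int 0" using \<rho> by simp
      then show ?thesis by blast
    next
      case True
      then have "a' \<in> C.roots \<hh>"
        using a' b0 by (auto simp: C.roots_def a'_def)
      then obtain n :: "nat \<Rightarrow> nat" where
        "a' = (\<lambda>H. \<Sum>i=1..N. of_nat (n i) * \<alpha> i H) \<or> a' = (\<lambda>H. - (\<Sum>i=1..N. of_nat (n i) * \<alpha> i H))"
        using simple_roots unfolding C.simple_system_def by blast
      then have "a' \<rho> = of_int (\<Sum>i=1..N. int (n i)) \<or> a' \<rho> = of_int (- (\<Sum>i=1..N. int (n i)))"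
        using \<alpha>\<rho> by (auto simp: of_int_sum)
      then show ?thesis by blast
    qed
    then show ?thesis
      using a' \<rho> by (auto simp: C.root_space_def)
  qed
  then obtain n where n: "\<And>b. b \<in> B \<Longrightarrow> cbracket br \<rho> b = cscale (of_int (n b)) b"
    by metis
  have "C.killing \<rho> \<rho> = (\<Sum>b\<in>B. C.representation B (cbracket br \<rho> (cbracket br \<rho> b)) b)"
    unfolding C.killing_def by (rule C.endo_trace_basis[OF B(2) spanB C.linear_bracket_bracket])
  also have "\<dots> = (\<Sum>b\<in>B. of_int ((n b)\<^sup>2))"
  proof (rule sum.cong[OF refl])
    fix b assume b: "b \<in> B"
    have "cbracket br \<rho> (cbracket br \<rho> b) = cscale (of_int ((n b)\<^sup>2)) b"
      using n[OF b] by (simp add: C.bracket_scale_right power2_eq_square)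
    then show "C.representation B (cbracket br \<rho> (cbracket br \<rho> b)) b = of_int ((n b)\<^sup>2)"
      using C.representation_scale[OF B(2)] C.representation_basis[OF B(2) b] spanB by simp
  qed
  also have "\<dots> = of_int (\<Sum>b\<in>B. (n b)\<^sup>2)"
    by simp
  finally have K: "C.killing \<rho> \<rho> = of_int (\<Sum>b\<in>B. (n b)\<^sup>2)" .
  \<comment> \<open>Otherwise \<open>\<rho>\<close> would act as zero on the span of
    \<open>B\<close>, yet it fixes the root vectors of \<open>\<alpha> 1\<close>.\<close>
  have "\<exists>b\<in>B. n b \<noteq> 0"
  proof (rule ccontr)
    assume "\<not> ?thesis"
    then have "B \<subseteq> {x. cbracket br \<rho> x = 0}" using n by auto
    moreover have "C.subspace {x. cbracket br \<rho> x = 0}"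
      by (rule C.subspaceI) (auto simp: C.bracket_add_right C.bracket_scale_right)
    ultimately have *: "C.span B \<subseteq> {x. cbracket br \<rho> x = 0}"
      by (rule C.span_minimal)
    have 1: "1 \<in> {1..N}" using N_pos by simp
    obtain x where x: "x \<in> C.root_space \<hh> (\<alpha> 1)" "x \<noteq> 0"
      using affine_root[of 1] 1 by (auto simp: C.roots_def)
    have "cbracket br \<rho> x = cscale 1 x"
      using x(1) \<rho> \<alpha>\<rho>[OF 1] by (simp add: C.root_space_def)
    moreover have "x \<in> C.span B" using spanB by simp
    ultimately show False using * x(2) by auto
  qed
  then have "(\<Sum>b\<in>B. (n b)\<^sup>2) \<noteq> 0"
    using finB by (subst sum_nonneg_eq_0_iff) auto
  then show ?thesis using K by (metis of_int_eq_0_iff)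
qed

section \<open>Affine roots and their differences\<close>

lemma opposite_root_vector:
  assumes "x \<in> C.root_space \<hh> a" "x \<noteq> 0"
  obtains y where "y \<in> C.root_space \<hh> (\<lambda>H. - a H)" "y \<noteq> 0"
proof -
  obtain u v where "C.killing u v \<noteq> 0" using killing_nonzero by blast
  from C.opposite_root_vector[OF simple_complexified this cartan assms]
  obtain y where "y \<in> C.root_space \<hh> (\<lambda>H. - a H)" "C.killing x y \<noteq> 0" .
  then show thesis using that by fastforce
qed

lemma sum_single: "j \<in> {1..N} \<Longrightarrow> (\<Sum>i=1..N. (if i = j then (c::complex) else 0) * f i) = c * f j"
  by (simp add: if_distrib[where f = "\<lambda>x. x * _"] cong: if_cong)

lemma affine_roots_distinct:
  assumes j: "j \<in> {0..N}" and l: "l \<in> {0..N}" and "j \<noteq> l"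
  shows "\<exists>H\<in>\<hh>. \<alpha> j H \<noteq> \<alpha> l H"
proof (rule ccontr)
  assume "\<not> ?thesis"
  then have eq: "\<And>H. H \<in> \<hh> \<Longrightarrow> \<alpha> j H = \<alpha> l H" by blast
  have zero: False if i: "i \<in> {1..N}" and e: "\<And>H. H \<in> \<hh> \<Longrightarrow> \<alpha> 0 H = \<alpha> i H" for i
  proof -
    obtain x where "x \<in> C.root_space \<hh> (\<alpha> i)" "x \<noteq> 0"
      using affine_root[of i] i by (auto simp: C.roots_def)
    then obtain y where "y \<in> C.root_space \<hh> (\<lambda>H. - \<alpha> i H)" "y \<noteq> 0"
      by (rule opposite_root_vector)
    then have "(\<lambda>H. - \<alpha> i H) \<in> C.roots \<hh>"
      using affine_root[of i] i by (auto simp: C.roots_def)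
    then obtain n :: "nat \<Rightarrow> nat" where n: "(\<lambda>H. - \<alpha> i H) = (\<lambda>H. \<alpha> 0 H + (\<Sum>i=1..N. of_nat (n i) * \<alpha> i H))"
      using lowest unfolding C.lowest_root_def by blast
    \<comment> \<open>With \<open>\<alpha> 0\<close> equal to \<open>\<alpha> i\<close>, moving
      \<open>- \<alpha> i\<close> to the right yields a vanishing combination in which
      \<open>\<alpha> i\<close> occurs twice more than \<open>n i\<close> says.\<close>
    have "of_nat (n i) + (if i = i then 2 else 0) = (0 :: complex)"
    proof (rule simple_root_coeff_zero[where c = "\<lambda>l. of_nat (n l) + (if l = i then 2 else 0)", OF _ i])
      fix H assume "H \<in> \<hh>"
      then show "(\<Sum>l=1..N. (of_nat (n l) + (if l = i then 2 else 0)) * \<alpha> l H) = 0"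
        using fun_cong[OF n, of H] e[of H] sum_single[OF i, of 2 "\<lambda>l. \<alpha> l H"]
        by (simp only: distrib_right sum.distrib) (simp add: algebra_simps eq_neg_iff_add_eq_0)
    qed
    then have "of_nat (n i + 2) = (0 :: complex)" by (simp add: add.commute)
    then show False by (simp only: of_nat_eq_0_iff)
  qed
  consider "j \<in> {1..N}" "l \<in> {1..N}" | "j = 0" "l \<in> {1..N}" | "l = 0" "j \<in> {1..N}"
    using assms by force
  then show False
  proof cases
    case 1
    have "(if j = j then 1 else 0) - (if j = l then 1 else 0) = (0 :: complex)"
    proof (rule simple_root_coeff_zero[where c = "\<lambda>i. (if i = j then 1 else 0) - (if i = l then 1 else 0)", OF _ 1(1)])
      fix H assume "H \<in> \<hh>"
      then show "(\<Sum>i=1..N. ((if i = j then 1 else 0) - (if i = l then 1 else 0)) * \<alpha> i H) = 0"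
        using eq sum_single[OF 1(1), of 1 "\<lambda>l. \<alpha> l H"] sum_single[OF 1(2), of 1 "\<lambda>l. \<alpha> l H"]
        by (simp only: left_diff_distrib sum_subtractf) simp
    qed
    then show False using \<open>j \<noteq> l\<close> by simp
  qed (use zero eq in fastforce)+
qed

text \<open>
  For \<^term>\<open>l = 0\<close> the difference is higher than any root can be; passing to its negative, which has a root
  vector because the Killing form is non-degenerate, turns this into the case \<^term>\<open>j = 0\<close>, where it is
  below the lowest root.
\<close>
lemma affine_root_difference:
  assumes j: "j \<in> {0..N}" and l: "l \<in> {0..N}" and "j \<noteq> l"
    and z: "z \<in> C.root_space \<hh> (\<lambda>H. \<alpha> j H - \<alpha> l H)"
  shows "z = 0"
proof -
  \<comment> \<open>Distinctness makes the difference non-zero on the Cartan subalgebra; outside it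
    both functions are 0, as \<open>roots\<close> demands.\<close>
  have root: "(\<lambda>H. \<alpha> j H - \<alpha> l H) \<in> C.roots \<hh>"
    if "j \<in> {0..N}" "l \<in> {0..N}" "j \<noteq> l" "z \<in> C.root_space \<hh> (\<lambda>H. \<alpha> j H - \<alpha> l H)" "z \<noteq> 0" for j l z
    using affine_roots_distinct[OF that(1-3)] that root_eq_0_outside[of j] root_eq_0_outside[of l]
    by (auto simp: C.roots_def)
  have pos: "z = 0" if j: "j \<in> {0..N}" and l: "l \<in> {1..N}" "j \<noteq> l"
    and z: "z \<in> C.root_space \<hh> (\<lambda>H. \<alpha> j H - \<alpha> l H)" for j l z
  proof (rule ccontr)
    assume "z \<noteq> 0"
    with root[of j l z] that have R: "(\<lambda>H. \<alpha> j H - \<alpha> l H) \<in> C.roots \<hh>" by simp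
    show False
    proof (cases "j = 0")
      case True
      obtain n :: "nat \<Rightarrow> nat" where
        n: "(\<lambda>H. \<alpha> j H - \<alpha> l H) = (\<lambda>H. \<alpha> 0 H + (\<Sum>i=1..N. of_nat (n i) * \<alpha> i H))"
        using R lowest unfolding C.lowest_root_def by blast
      \<comment> \<open>Here \<open>\<alpha> 0\<close> cancels, leaving \<open>- \<alpha> l\<close>
        as a non-negative combination of simple roots.\<close>
      have "of_nat (n l) + (if l = l then 1 else 0) = (0 :: complex)"
      proof (rule simple_root_coeff_zero[where c = "\<lambda>i. of_nat (n i) + (if i = l then 1 else 0)", OF _ l(1)])
        fix H
        show "(\<Sum>i=1..N. (of_nat (n i) + (if i = l then 1 else 0)) * \<alpha> i H) = 0"
          using fun_cong[OF n, of H] True sum_single[OF l(1), of 1 "\<lambda>l. \<alpha> l H"]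
          by (simp only: distrib_right sum.distrib) (simp add: algebra_simps)
      qed
      then have "of_nat (n l + 1) = (0 :: complex)" by (simp add: add.commute)
      then show False by (simp only: of_nat_eq_0_iff)
    next
      case False
      then have j1: "j \<in> {1..N}" using j by simp
      obtain n :: "nat \<Rightarrow> nat" where
        "(\<lambda>H. \<alpha> j H - \<alpha> l H) = (\<lambda>H. \<Sum>i=1..N. of_nat (n i) * \<alpha> i H) \<or>
         (\<lambda>H. \<alpha> j H - \<alpha> l H) = (\<lambda>H. - (\<Sum>i=1..N. of_nat (n i) * \<alpha> i H))"
        using R simple_roots unfolding C.simple_system_def by blast
      \<comment> \<open>A non-negative combination clashes at index \<open>l\<close>, a non-positive
        one at \<open>j\<close>; the other indicator is 0 there because
        \<open>j \<noteq> l\<close>.\<close>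
      then show False
      proof
        assume n: "(\<lambda>H. \<alpha> j H - \<alpha> l H) = (\<lambda>H. \<Sum>i=1..N. of_nat (n i) * \<alpha> i H)"
        have "of_nat (n l) + (if l = l then 1 else 0) - (if l = j then 1 else 0) = (0 :: complex)"
        proof (rule simple_root_coeff_zero[where
              c = "\<lambda>i. of_nat (n i) + (if i = l then 1 else 0) - (if i = j then 1 else 0)", OF _ l(1)])
          fix H
          show "(\<Sum>i=1..N. (of_nat (n i) + (if i = l then 1 else 0) - (if i = j then 1 else 0)) * \<alpha> i H) = 0"
            using fun_cong[OF n, of H] sum_single[OF l(1), of 1 "\<lambda>l. \<alpha> l H"] sum_single[OF j1, of 1 "\<lambda>l. \<alpha> l H"]
            by (simp only: distrib_right sum.distrib left_diff_distrib sum_subtractf) (simp add: algebra_simps)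
        qed
        then have "of_nat (n l + 1) = (0 :: complex)" using l(2) by (simp add: add.commute)
        then show False by (simp only: of_nat_eq_0_iff)
      next
        assume n: "(\<lambda>H. \<alpha> j H - \<alpha> l H) = (\<lambda>H. - (\<Sum>i=1..N. of_nat (n i) * \<alpha> i H))"
        have "of_nat (n j) + (if j = j then 1 else 0) - (if j = l then 1 else 0) = (0 :: complex)"
        proof (rule simple_root_coeff_zero[where
              c = "\<lambda>i. of_nat (n i) + (if i = j then 1 else 0) - (if i = l then 1 else 0)", OF _ j1])
          fix H
          show "(\<Sum>i=1..N. (of_nat (n i) + (if i = j then 1 else 0) - (if i = l then 1 else 0)) * \<alpha> i H) = 0"
            using fun_cong[OF n, of H] sum_single[OF l(1), of 1 "\<lambda>l. \<alpha> l H"] sum_single[OF j1, of 1 "\<lambda>l. \<alpha> l H"]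
            by (simp only: distrib_right sum.distrib left_diff_distrib sum_subtractf) (simp add: algebra_simps)
        qed
        then have "of_nat (n j + 1) = (0 :: complex)" using l(2) by (simp add: add.commute)
        then show False by (simp only: of_nat_eq_0_iff)
      qed
    qed
  qed
  show ?thesis
  proof (cases "l = 0")
    case False
    then show ?thesis using pos[of j l z] assms by simp
  next
    case True
    show ?thesis
    proof (rule ccontr)
      assume "z \<noteq> 0"
      with z obtain y where "y \<in> C.root_space \<hh> (\<lambda>H. - (\<alpha> j H - \<alpha> l H))" "y \<noteq> 0"
        by (rule opposite_root_vector)
      moreover have "(\<lambda>H. - (\<alpha> j H - \<alpha> l H)) = (\<lambda>H. \<alpha> l H - \<alpha> j H)" by auto
      ultimately show False
        using pos[of l j y] True assms(1-3) by auto
    qed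
  qed
qed

lemma bracket_affine_root_vectors:
  assumes j: "j \<in> {0..N}" and l: "l \<in> {0..N}"
    and x: "x \<in> C.root_space \<hh> (\<alpha> j)" and y: "y \<in> C.root_space \<hh> (\<lambda>H. - \<alpha> l H)"
  shows "cbracket br x y = (if j = l then cscale (C.killing x y) (C.killing_sharp \<hh> (\<alpha> j)) else 0)"
proof (cases "j = l")
  case True
  obtain u v where "C.killing u v \<noteq> 0" using killing_nonzero by blast
  moreover have "\<exists>w\<in>C.root_space \<hh> (\<alpha> j). w \<noteq> 0"
    using affine_root[OF j] by (auto simp: C.roots_def)
  ultimately show ?thesis
    using C.bracket_opposite_root_vectors_sharp[OF simple_complexified _ cartan x] y True by simp
next
  case False
  then show ?thesis
    using affine_root_difference[OF j l False] C.bracket_root_spaces[OF x y] by simp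
qed

text \<open>Conjugating twice is the identity, so \<open>\<alpha> (\<pi> (\<pi> j))\<close> and
  \<open>\<alpha> j\<close> coincide, and affine roots with different indices are distinct.\<close>

lemma perm_involution:
  assumes j: "j \<in> {0..N}"
  shows "\<pi> (\<pi> j) = j"
proof (rule ccontr)
  have in1: "\<pi> j \<in> {0..N}" and in2: "\<pi> (\<pi> j) \<in> {0..N}"
    using bij_betwE[OF perm] j by blast+
  have "\<alpha> (\<pi> (\<pi> j)) X = \<alpha> j X" for X
  proof -
    have "\<alpha> (\<pi> (\<pi> j)) X = - cnj (\<alpha> (\<pi> j) (cconj X))"
      using conj_roots[rule_format, OF in1, of X] by simp
    also have "\<dots> = cnj (cnj (\<alpha> j (cconj (cconj X))))"
      using conj_roots[rule_format, OF j, of "cconj X"] by simp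
    finally show ?thesis by (simp add: cconj_def)
  qed
  moreover assume "\<pi> (\<pi> j) \<noteq> j"
  ultimately show False
    using affine_roots_distinct[OF in2 j] by auto
qed

end

section \<open>Directional derivatives in the plane\<close>

lemma dir_deriv_eqI: "(f has_derivative f') (at z) \<Longrightarrow> dir_deriv f v z = f' v"
  unfolding dir_deriv_def by (metis frechet_derivative_at)

lemma differentiable_imp_has_dir_deriv:
  "f differentiable at z \<Longrightarrow> (f has_derivative (\<lambda>v. dir_deriv f v z)) (at z)"
  unfolding dir_deriv_def using frechet_derivative_works by blast

lemma dir_deriv_line:
  fixes g :: "complex \<Rightarrow> real"
  assumes "\<And>z. g differentiable at z"
  shows "((\<lambda>s. g (x + s *\<^sub>R u)) has_real_derivative dir_deriv g u (x + s *\<^sub>R u)) (at s)"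
proof -
  interpret D: bounded_linear "\<lambda>v. dir_deriv g v (x + s *\<^sub>R u)"
    using has_derivative_bounded_linear[OF differentiable_imp_has_dir_deriv[OF assms]] .
  have "((\<lambda>s. x + s *\<^sub>R u) has_derivative (\<lambda>s. s *\<^sub>R u)) (at s)"
    by (auto intro!: derivative_eq_intros)
  from has_derivative_compose[OF this differentiable_imp_has_dir_deriv[OF assms]]
  have "((\<lambda>s. g (x + s *\<^sub>R u)) has_derivative (\<lambda>r. dir_deriv g (r *\<^sub>R u) (x + s *\<^sub>R u))) (at s)"
    by (simp add: o_def)
  then show ?thesis
    by (simp add: has_field_derivative_def D.scaleR mult_commute_abs)
qed

text \<open>The mean value theorem is applied along \<open>u\<close> to a difference of translates
  by \<open>h\<close> times \<open>v\<close>, then along \<open>v\<close>. The left side is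
  symmetric in \<open>u\<close> and \<open>v\<close>, which gives the symmetry of second
  derivatives.\<close>

lemma second_difference_mean_value:
  fixes g :: "complex \<Rightarrow> real"
  assumes g: "\<And>z. g differentiable at z" and gu: "\<And>z. dir_deriv g u differentiable at z"
    and h: "h > 0"
  obtains s r where "0 < s" "s < h" "0 < r" "r < h"
    "g (z + h *\<^sub>R u + h *\<^sub>R v) - g (z + h *\<^sub>R u) - g (z + h *\<^sub>R v) + g z =
     h * h * dir_deriv (dir_deriv g u) v (z + s *\<^sub>R u + r *\<^sub>R v)"
proof -
  let ?\<phi> = "\<lambda>s. g ((z + h *\<^sub>R v) + s *\<^sub>R u) - g (z + s *\<^sub>R u)"
  let ?\<phi>' = "\<lambda>s. dir_deriv g u ((z + h *\<^sub>R v) + s *\<^sub>R u) - dir_deriv g u (z + s *\<^sub>R u)"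
  have "\<exists>s>0. s < h \<and> ?\<phi> h - ?\<phi> 0 = (h - 0) * ?\<phi>' s"
    by (rule MVT2[OF h]) (intro DERIV_diff dir_deriv_line g)
  then obtain s where s: "0 < s" "s < h" "?\<phi> h - ?\<phi> 0 = h * ?\<phi>' s" by auto
  let ?\<psi> = "\<lambda>r. dir_deriv g u ((z + s *\<^sub>R u) + r *\<^sub>R v)"
  have "\<exists>r>0. r < h \<and> ?\<psi> h - ?\<psi> 0 = (h - 0) * dir_deriv (dir_deriv g u) v ((z + s *\<^sub>R u) + r *\<^sub>R v)"
    by (rule MVT2[OF h]) (intro dir_deriv_line gu)
  then obtain r where r: "0 < r" "r < h"
    "?\<psi> h - ?\<psi> 0 = h * dir_deriv (dir_deriv g u) v ((z + s *\<^sub>R u) + r *\<^sub>R v)" by auto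
  have "?\<phi>' s = ?\<psi> h - ?\<psi> 0"
    by (simp add: algebra_simps)
  with s r have "?\<phi> h - ?\<phi> 0 = h * h * dir_deriv (dir_deriv g u) v (z + s *\<^sub>R u + r *\<^sub>R v)"
    by simp
  then show thesis
    using that[OF s(1,2) r(1,2)] by (simp add: algebra_simps)
qed

lemma dir_deriv_symmetric_real:
  fixes g :: "complex \<Rightarrow> real"
  assumes g: "\<And>z. g differentiable at z" and gd: "\<And>v z. dir_deriv g v differentiable at z"
    and cont: "\<And>u v. continuous_on UNIV (dir_deriv (dir_deriv g u) v)"
  shows "dir_deriv (dir_deriv g u) v z = dir_deriv (dir_deriv g v) u z"
proof -
  let ?p = "\<lambda>n s r. z + s n *\<^sub>R u + r n *\<^sub>R v"
  define h where "h n = inverse (real (Suc n))" for n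
  have h: "h n > 0" for n by (simp add: h_def)
  have h0: "h \<longlonglongrightarrow> 0" unfolding h_def by (rule LIMSEQ_inverse_real_of_nat)
  have "\<exists>s r s' r'. 0 < s \<and> s < h n \<and> 0 < r \<and> r < h n \<and> 0 < s' \<and> s' < h n \<and> 0 < r' \<and> r' < h n \<and>
      dir_deriv (dir_deriv g u) v (z + s *\<^sub>R u + r *\<^sub>R v) = dir_deriv (dir_deriv g v) u (z + s' *\<^sub>R u + r' *\<^sub>R v)" for n
  proof -
    obtain s r where 1: "0 < s" "s < h n" "0 < r" "r < h n"
      "g (z + h n *\<^sub>R u + h n *\<^sub>R v) - g (z + h n *\<^sub>R u) - g (z + h n *\<^sub>R v) + g z =
       h n * h n * dir_deriv (dir_deriv g u) v (z + s *\<^sub>R u + r *\<^sub>R v)"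
      by (rule second_difference_mean_value[OF g gd h, of n z u v])
    \<comment> \<open>The same second difference with \<open>u\<close> and \<open>v\<close>
      exchanged. The two mixed derivatives agree at points that tend to \<open>z\<close>, and
      continuity finishes.\<close>
    obtain r' s' where 2: "0 < r'" "r' < h n" "0 < s'" "s' < h n"
      "g (z + h n *\<^sub>R v + h n *\<^sub>R u) - g (z + h n *\<^sub>R v) - g (z + h n *\<^sub>R u) + g z =
       h n * h n * dir_deriv (dir_deriv g v) u (z + r' *\<^sub>R v + s' *\<^sub>R u)"
      by (rule second_difference_mean_value[OF g gd h, of n z v u])
    have "h n * h n * dir_deriv (dir_deriv g u) v (z + s *\<^sub>R u + r *\<^sub>R v) =
        h n * h n * dir_deriv (dir_deriv g v) u (z + s' *\<^sub>R u + r' *\<^sub>R v)"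
    proof -
      have "z + h n *\<^sub>R v + h n *\<^sub>R u = z + h n *\<^sub>R u + h n *\<^sub>R v"
        "z + r' *\<^sub>R v + s' *\<^sub>R u = z + s' *\<^sub>R u + r' *\<^sub>R v"
        by (simp_all only: ac_simps)
      then show ?thesis
        using 1(5) 2(5) by (simp only:)
    qed
    then show ?thesis
      using 1 2 h[of n] by (intro exI[of _ s] exI[of _ r] exI[of _ s'] exI[of _ r']) auto
  qed
  then obtain s r s' r' where *: "\<And>n. 0 < s n" "\<And>n. s n < h n" "\<And>n. 0 < r n" "\<And>n. r n < h n"
      "\<And>n. 0 < s' n" "\<And>n. s' n < h n" "\<And>n. 0 < r' n" "\<And>n. r' n < h n"
      "\<And>n. dir_deriv (dir_deriv g u) v (?p n s r) = dir_deriv (dir_deriv g v) u (?p n s' r')"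
    by metis
  have to0: "f \<longlonglongrightarrow> 0" if "\<And>n. 0 < f n" "\<And>n. f n < h n" for f
    using that by (intro tendsto_sandwich[OF _ _ tendsto_const h0]) (auto intro!: always_eventually less_imp_le)
  have p: "(\<lambda>n. ?p n s r) \<longlonglongrightarrow> z" if "s \<longlonglongrightarrow> 0" "r \<longlonglongrightarrow> 0" for s r
  proof -
    have "(\<lambda>n. ?p n s r) \<longlonglongrightarrow> z + 0 *\<^sub>R u + 0 *\<^sub>R v"
      by (intro tendsto_intros that)
    then show ?thesis by simp
  qed
  have lim: "(\<lambda>n. F (?p n s r)) \<longlonglongrightarrow> F z"
    if "continuous_on UNIV F" "s \<longlonglongrightarrow> 0" "r \<longlonglongrightarrow> 0" for F :: "complex \<Rightarrow> real" and s r
    using continuous_on_tendsto_compose[OF that(1) p[OF that(2,3)]] by simp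
  show ?thesis
    using LIMSEQ_unique[OF lim[OF cont, of s r u v]] lim[OF cont, of s' r' v u] to0 *
    by simp
qed

lemma dir_deriv_inner:
  assumes "f differentiable at z"
  shows "dir_deriv (\<lambda>x. f x \<bullet> b) v z = dir_deriv f v z \<bullet> b"
  using has_derivative_inner_left[OF differentiable_imp_has_dir_deriv[OF assms]] by (rule dir_deriv_eqI)

lemma dir_deriv_symmetric:
  fixes f :: "complex \<Rightarrow> 'b::euclidean_space"
  assumes f: "\<And>z. f differentiable at z" and fd: "\<And>v z. dir_deriv f v differentiable at z"
    and cont: "\<And>u v. continuous_on UNIV (dir_deriv (dir_deriv f u) v)"
  shows "dir_deriv (dir_deriv f u) v z = dir_deriv (dir_deriv f v) u z"
proof (rule euclidean_eqI)
  fix b :: 'b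
  let ?g = "\<lambda>x. f x \<bullet> b"
  have 1: "dir_deriv ?g v = (\<lambda>x. dir_deriv f v x \<bullet> b)" for v
    using dir_deriv_inner[OF f] by blast
  have 2: "dir_deriv (dir_deriv ?g u) v = (\<lambda>x. dir_deriv (dir_deriv f u) v x \<bullet> b)" for u v
    unfolding 1 using dir_deriv_inner[OF fd] by blast
  have "dir_deriv (dir_deriv ?g u) v z = dir_deriv (dir_deriv ?g v) u z"
  proof (rule dir_deriv_symmetric_real)
    show "?g differentiable at z" for z
      using has_derivative_inner_left[OF differentiable_imp_has_dir_deriv[OF f]] by (rule differentiableI)
    show "dir_deriv ?g v differentiable at z" for v z
      unfolding 1 using has_derivative_inner_left[OF differentiable_imp_has_dir_deriv[OF fd]] by (rule differentiableI)
    show "continuous_on UNIV (dir_deriv (dir_deriv ?g u) v)" for u v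
      unfolding 2 by (intro continuous_intros cont)
  qed
  then show "dir_deriv (dir_deriv f u) v z \<bullet> b = dir_deriv (dir_deriv f v) u z \<bullet> b"
    by (simp add: 2)
qed

section \<open>The zero-curvature equation\<close>

text \<open>A linear projection \<open>P\<close> onto \<open>S\<close> fixes \<open>f\<close>, so by
  uniqueness of derivatives it fixes \<open>f'\<close>.\<close>

lemma has_derivative_in_subspace:
  fixes f :: "'a::real_normed_vector \<Rightarrow> 'b::euclidean_space"
  assumes f: "(f has_derivative f') (at z)" and S: "subspace S" "\<And>x. f x \<in> S"
  shows "f' v \<in> S"
proof -
  obtain P :: "'b \<Rightarrow> 'b" where P: "range P \<subseteq> S" "linear P" "\<And>x. x \<in> S \<Longrightarrow> P x = x"
    using linear_exists_left_inverse_on[OF linear_id S(1)] by auto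
  have "((\<lambda>x. P (f x)) has_derivative (\<lambda>v. P (f' v))) (at z)"
    using P(2) by (intro bounded_linear.has_derivative[OF _ f]) (simp add: linear_conv_bounded_linear)
  moreover have "(\<lambda>x. P (f x)) = f"
    using P(3) S(2) by auto
  ultimately have "f' = (\<lambda>v. P (f' v))"
    using f has_derivative_unique by metis
  then show ?thesis using P(1) by (metis rangeI subsetD)
qed

lemma bounded_linear_cscale_left: "bounded_linear (\<lambda>c. cscale c (X :: 'g::euclidean_space complexified))"
  unfolding linear_conv_bounded_linear[symmetric]
  by (rule linearI) (auto simp: cscale_def prod_eq_iff algebra_simps)

lemma bounded_linear_cscale_right: "bounded_linear (cscale c :: 'g::euclidean_space complexified \<Rightarrow> _)"
  unfolding linear_conv_bounded_linear[symmetric]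
  by (rule linearI) (auto simp: cscale_def prod_eq_iff algebra_simps)

text \<open>\<open>Y\<close> and its multiple by the imaginary unit are orthogonal of equal norm, so
  two inner products recover the real and imaginary parts of \<open>c\<close>.\<close>

lemma cscale_coefficient_functional:
  fixes Y :: "'g::euclidean_space complexified"
  assumes "Y \<noteq> 0"
  obtains \<phi> :: "'g complexified \<Rightarrow> complex" where "bounded_linear \<phi>" "\<And>c. \<phi> (cscale c Y) = c"
proof
  let ?\<phi> = "\<lambda>v. Complex ((v \<bullet> Y) / (Y \<bullet> Y)) ((v \<bullet> cscale \<i> Y) / (Y \<bullet> Y))"
  show "bounded_linear ?\<phi>"
    unfolding linear_conv_bounded_linear[symmetric]
    by (rule linearI) (auto simp: complex_eq_iff inner_add_left add_divide_distrib)
  have Y: "Y \<bullet> Y \<noteq> 0" using assms by simp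
  have "cscale c Y \<bullet> Y = Re c * (Y \<bullet> Y)" "cscale c Y \<bullet> cscale \<i> Y = Im c * (Y \<bullet> Y)" for c
    by (simp_all add: cscale_def inner_prod_def inner_diff_left inner_add_left inner_commute algebra_simps)
  then show "?\<phi> (cscale c Y) = c" for c
    using Y by (simp add: complex_eq_iff)
qed

context coxeter_setting
begin

lemma bounded_linear_cbracket_left: "bounded_linear (\<lambda>H. cbracket br H Y)"
  unfolding linear_conv_bounded_linear[symmetric]
  by (rule linearI) (simp_all add: C.bracket_add_left scaleR_eq_cscale C.bracket_scale_left)

text \<open>Powers of ad act on each \<open>Y j\<close> by powers of \<open>a j H\<close>, so the
  operator series becomes the scalar exponential series.\<close>

lemma Ad_exp_root_vectors:
  assumes H: "H \<in> \<hh>" and Y: "\<And>j. j \<in> J \<Longrightarrow> Y j \<in> C.root_space \<hh> (a j)"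
  shows "Ad_exp br H (\<Sum>j\<in>J. cscale (c j) (Y j)) = (\<Sum>j\<in>J. cscale (exp (a j H) * c j) (Y j))"
proof -
  have pow: "(cbracket br H ^^ n) (\<Sum>j\<in>J. cscale (c j) (Y j)) = (\<Sum>j\<in>J. cscale (a j H ^ n * c j) (Y j))" for n
  proof (induction n)
    case (Suc n)
    then show ?case
      using H Y by (simp add: C.bracket_sum_right C.bracket_scale_right C.root_space_def mult_ac)
  qed simp
  have "(\<lambda>n. \<Sum>j\<in>J. cscale ((a j H ^ n /\<^sub>R fact n) * c j) (Y j)) sums
      (\<Sum>j\<in>J. cscale (exp (a j H) * c j) (Y j))"
    by (intro sums_sum bounded_linear.sums[OF bounded_linear_cscale_left]
        bounded_linear.sums[OF bounded_linear_mult_left] exp_converges)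
  moreover have "(1 / fact n) *\<^sub>R (cbracket br H ^^ n) (\<Sum>j\<in>J. cscale (c j) (Y j)) =
      (\<Sum>j\<in>J. cscale ((a j H ^ n /\<^sub>R fact n) * c j) (Y j))" for n
    unfolding pow by (simp add: scaleR_eq_cscale C.scale_sum_right scaleR_conv_of_real divide_inverse mult_ac)
  ultimately show ?thesis
    unfolding Ad_exp_def by (simp add: sums_iff)
qed

text \<open>
  A root is only linear on \<^term>\<open>\<hh>\<close>, being zero outside; for the chain rule it is replaced by a
  bounded real-linear functional on the whole algebra.
\<close>
lemma has_derivative_Ad_exp:
  fixes \<Omega> :: "complex \<Rightarrow> 'g complexified" and c :: "'i \<Rightarrow> complex"
  assumes \<Omega>: "(\<Omega> has_derivative \<Omega>') (at z)" "\<And>x. \<Omega> x \<in> \<hh>" "\<And>v. \<Omega>' v \<in> \<hh>"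
    and Y: "\<And>j. j \<in> J \<Longrightarrow> Y j \<in> C.root_space \<hh> (a j)" "\<And>j. j \<in> J \<Longrightarrow> Y j \<noteq> 0"
  defines "X \<equiv> \<Sum>j\<in>J. cscale (c j) (Y j)"
  shows "((\<lambda>x. Ad_exp br (\<Omega> x) X) has_derivative (\<lambda>v. cbracket br (\<Omega>' v) (Ad_exp br (\<Omega> z) X))) (at z)"
proof -
  have "\<exists>g. bounded_linear g \<and> (\<forall>H\<in>\<hh>. g H = a j H)" if j: "j \<in> J" for j
  proof -
    obtain \<phi> :: "'g complexified \<Rightarrow> complex" where \<phi>: "bounded_linear \<phi>" "\<And>c. \<phi> (cscale c (Y j)) = c"
      using cscale_coefficient_functional[OF Y(2)[OF j]] by blast
    \<comment> \<open>The bracket is linear everywhere, so reading off the coefficient of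
      \<open>Y j\<close> in it extends the root linearly.\<close>
    have "bounded_linear (\<lambda>H. \<phi> (cbracket br H (Y j)))"
      by (rule bounded_linear_compose[OF \<phi>(1) bounded_linear_cbracket_left])
    moreover have "\<phi> (cbracket br H (Y j)) = a j H" if "H \<in> \<hh>" for H
      using Y(1)[OF j] that \<phi>(2) by (simp add: C.root_space_def)
    ultimately show ?thesis by blast
  qed
  then obtain g where g: "\<And>j. j \<in> J \<Longrightarrow> bounded_linear (g j)" "\<And>j H. j \<in> J \<Longrightarrow> H \<in> \<hh> \<Longrightarrow> g j H = a j H"
    by metis
  have "((\<lambda>x. \<Sum>j\<in>J. cscale (exp (g j (\<Omega> x)) * c j) (Y j)) has_derivative
      (\<lambda>v. \<Sum>j\<in>J. cscale (g j (\<Omega>' v) * exp (g j (\<Omega> z)) * c j) (Y j))) (at z)"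
  proof (intro has_derivative_sum bounded_linear.has_derivative[OF bounded_linear_cscale_left]
      has_derivative_mult_left)
    fix j assume "j \<in> J"
    show "((\<lambda>x. exp (g j (\<Omega> x))) has_derivative (\<lambda>v. g j (\<Omega>' v) * exp (g j (\<Omega> z)))) (at z)"
      using has_derivative_compose[OF bounded_linear.has_derivative[OF g(1)[OF \<open>j \<in> J\<close>] \<Omega>(1)]
          DERIV_exp[THEN has_field_derivative_imp_has_derivative]]
      by (simp add: mult.commute)
  qed
  moreover have "(\<lambda>x. Ad_exp br (\<Omega> x) X) = (\<lambda>x. \<Sum>j\<in>J. cscale (exp (g j (\<Omega> x)) * c j) (Y j))"
    unfolding X_def using \<Omega>(2) g(2) by (simp add: Ad_exp_root_vectors[OF \<Omega>(2) Y(1)])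
  moreover have "(\<lambda>v. cbracket br (\<Omega>' v) (Ad_exp br (\<Omega> z) X)) =
      (\<lambda>v. \<Sum>j\<in>J. cscale (g j (\<Omega>' v) * exp (g j (\<Omega> z)) * c j) (Y j))"
  proof
    fix v
    have "cbracket br (\<Omega>' v) (Y j) = cscale (a j (\<Omega>' v)) (Y j)" if "j \<in> J" for j
      using Y(1)[OF that] \<Omega>(3) by (simp add: C.root_space_def)
    then show "cbracket br (\<Omega>' v) (Ad_exp br (\<Omega> z) X) =
        (\<Sum>j\<in>J. cscale (g j (\<Omega>' v) * exp (g j (\<Omega> z)) * c j) (Y j))"
      unfolding X_def using \<Omega>(2,3) g(2)
      by (simp add: Ad_exp_root_vectors[OF \<Omega>(2) Y(1)] C.bracket_sum_right C.bracket_scale_right mult_ac)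
  qed
  ultimately show ?thesis by simp
qed

section \<open>Wirtinger derivatives and the curvature of a one-form\<close>

lemma d_z_eq: "d_z f z = cscale (1/2) (dir_deriv f 1 z) - cscale (\<i>/2) (dir_deriv f \<i> z)"
  and d_zbar_eq: "d_zbar f z = cscale (1/2) (dir_deriv f 1 z) + cscale (\<i>/2) (dir_deriv f \<i> z)"
  for f :: "complex \<Rightarrow> 'g complexified"
  by (simp_all add: d_z_def d_zbar_def scaleR_eq_cscale C.scale_right_diff_distrib C.scale_right_distrib)

lemma dir_deriv_wirtinger:
  fixes f :: "complex \<Rightarrow> 'g complexified"
  assumes "f differentiable at z"
  shows "dir_deriv f u z = cscale u (d_z f z) + cscale (cnj u) (d_zbar f z)"
proof -
  interpret D: bounded_linear "\<lambda>v. dir_deriv f v z"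
    using has_derivative_bounded_linear[OF differentiable_imp_has_dir_deriv[OF assms]] .
  have "dir_deriv f u z = dir_deriv f (Re u *\<^sub>R 1 + Im u *\<^sub>R \<i>) z"
    by (rule arg_cong[where f = "\<lambda>u. dir_deriv f u z"]) (simp add: complex_eq_iff)
  also have "\<dots> = cscale (of_real (Re u)) (dir_deriv f 1 z) + cscale (of_real (Im u)) (dir_deriv f \<i> z)"
    by (simp only: D.add D.scaleR scaleR_eq_cscale)
  also have "\<dots> = cscale (u / 2 + cnj u / 2) (dir_deriv f 1 z) + cscale (cnj u * \<i> / 2 - u * \<i> / 2) (dir_deriv f \<i> z)"
    by (intro arg_cong2[where f = "(+)"] arg_cong2[where f = cscale]) (auto simp: complex_eq_iff)
  finally show ?thesis
    unfolding d_z_eq d_zbar_eq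
    by (simp add: C.scale_right_distrib C.scale_right_diff_distrib C.scale_left_distrib C.scale_left_diff_distrib)
qed

text \<open>The left side of the equation is alternating in \<open>u\<close> and \<open>v\<close>,
  hence the curvature times the value of dz wedge its conjugate on them.\<close>

lemma maurer_cartan_iff:
  fixes A B :: "complex \<Rightarrow> 'g complexified"
  assumes A: "\<And>z. A differentiable at z" and B: "\<And>z. B differentiable at z"
  shows "maurer_cartan br (\<lambda>z v. cscale v (A z) + cscale (cnj v) (B z)) \<longleftrightarrow>
    (\<forall>z. d_z B z - d_zbar A z + cbracket br (A z) (B z) = 0)"
proof -
  let ?\<omega> = "\<lambda>z v. cscale v (A z) + cscale (cnj v) (B z)"
  let ?K = "\<lambda>z. d_z B z - d_zbar A z + cbracket br (A z) (B z)"
  have D: "dir_deriv (\<lambda>x. ?\<omega> x v) u z =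
      cscale v (cscale u (d_z A z) + cscale (cnj u) (d_zbar A z)) +
      cscale (cnj v) (cscale u (d_z B z) + cscale (cnj u) (d_zbar B z))" for u v z
    unfolding dir_deriv_wirtinger[OF A, symmetric] dir_deriv_wirtinger[OF B, symmetric]
    by (rule dir_deriv_eqI)
      (intro has_derivative_add bounded_linear.has_derivative[OF bounded_linear_cscale_right]
        differentiable_imp_has_dir_deriv A B)
  have K: "dir_deriv (\<lambda>x. ?\<omega> x v) u z - dir_deriv (\<lambda>x. ?\<omega> x u) v z + cbracket br (?\<omega> z u) (?\<omega> z v) =
      cscale (u * cnj v - cnj u * v) (?K z)" for u v z
    unfolding D using C.bracket_anticommute[of "B z" "A z"]
    by (simp add: C.bracket_add_left C.bracket_add_right C.bracket_scale_left C.bracket_scale_right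
        C.bracket_alternating C.scale_right_distrib C.scale_right_diff_distrib
        C.scale_left_diff_distrib algebra_simps)
  have "?K z = 0" if "\<forall>z u v. cscale (u * cnj v - cnj u * v) (?K z) = 0" for z
  proof -
    \<comment> \<open>On the pair 1, \<open>\<i>\<close> the scalar factor is
      \<open>- 2 * \<i>\<close>, which can be cancelled.\<close>
    have "cscale (1 * cnj \<i> - cnj 1 * \<i>) (?K z) = 0" using that by blast
    moreover have "1 * cnj \<i> - cnj 1 * \<i> \<noteq> 0" by (simp add: complex_eq_iff)
    ultimately show ?thesis by (simp only: C.scale_eq_0_iff) blast
  qed
  then show ?thesis
    unfolding maurer_cartan_def K by auto
qed

lemma toda_curvature:
  fixes \<Omega> :: "complex \<Rightarrow> 'g complexified" and W W' :: "'g complexified"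
  assumes \<Omega>: "smooth \<Omega>" "\<And>z. \<Omega> z \<in> \<hh>"
    and Y: "\<And>j. j \<in> J \<Longrightarrow> Y j \<in> C.root_space \<hh> (a j) \<and> Y j \<noteq> 0"
    and Y': "\<And>j. j \<in> J' \<Longrightarrow> Y' j \<in> C.root_space \<hh> (a' j) \<and> Y' j \<noteq> 0"
    and W: "W = (\<Sum>j\<in>J. cscale (c j) (Y j))" and W': "W' = (\<Sum>j\<in>J'. cscale (c' j) (Y' j))"
  defines "A \<equiv> \<lambda>z. d_z \<Omega> z + Ad_exp br (\<Omega> z) W" and "B \<equiv> \<lambda>z. - d_zbar \<Omega> z + Ad_exp br (- \<Omega> z) W'"
  shows "A differentiable at z" "B differentiable at z"
    and "d_z B z - d_zbar A z + cbracket br (A z) (B z) =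
      cbracket br (Ad_exp br (\<Omega> z) W) (Ad_exp br (- \<Omega> z) W') - 2 *\<^sub>R d_zbar (d_z \<Omega>) z"
proof -
  have "k_times_cont_diff (Suc (Suc 0)) \<Omega>"
    using \<Omega>(1) unfolding smooth_def by blast
  then have diff: "\<And>z. \<Omega> differentiable at z" "\<And>v z. dir_deriv \<Omega> v differentiable at z"
      "\<And>u v. continuous_on UNIV (dir_deriv (dir_deriv \<Omega> u) v)"
    by auto
  have real_sub: "subspace \<hh>"
    using subspace_cartan
    by (intro subspaceI) (auto simp: scaleR_eq_cscale C.subspace_0 C.subspace_add C.subspace_scale)
  note D = differentiable_imp_has_dir_deriv[OF diff(1)]
  have D\<hh>: "dir_deriv \<Omega> v z \<in> \<hh>" for v z
    by (rule has_derivative_in_subspace[OF D real_sub \<Omega>(2)])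
  have neg\<hh>: "- H \<in> \<hh>" if "H \<in> \<hh>" for H
    using that by (rule C.subspace_neg[OF subspace_cartan])
  have P: "((\<lambda>x. Ad_exp br (\<Omega> x) W) has_derivative
      (\<lambda>v. cbracket br (dir_deriv \<Omega> v z) (Ad_exp br (\<Omega> z) W))) (at z)" for z
    unfolding W using Y by (intro has_derivative_Ad_exp[OF D \<Omega>(2) D\<hh>]) auto
  have Q: "((\<lambda>x. Ad_exp br (- \<Omega> x) W') has_derivative
      (\<lambda>v. cbracket br (- dir_deriv \<Omega> v z) (Ad_exp br (- \<Omega> z) W'))) (at z)" for z
    unfolding W' using Y' by (intro has_derivative_Ad_exp[OF has_derivative_minus[OF D] neg\<hh>[OF \<Omega>(2)] neg\<hh>[OF D\<hh>]]) auto
  let ?DD = "\<lambda>u v. dir_deriv (dir_deriv \<Omega> u) v z"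
  have dz: "(d_z \<Omega> has_derivative
      (\<lambda>v. cscale (1/2) (dir_deriv (dir_deriv \<Omega> 1) v z) - cscale (\<i>/2) (dir_deriv (dir_deriv \<Omega> \<i>) v z))) (at z)" for z
    unfolding d_z_eq[abs_def]
    by (intro has_derivative_diff bounded_linear.has_derivative[OF bounded_linear_cscale_right]
        differentiable_imp_has_dir_deriv diff)
  have dzbar: "(d_zbar \<Omega> has_derivative
      (\<lambda>v. cscale (1/2) (dir_deriv (dir_deriv \<Omega> 1) v z) + cscale (\<i>/2) (dir_deriv (dir_deriv \<Omega> \<i>) v z))) (at z)" for z
    unfolding d_zbar_eq[abs_def]
    by (intro has_derivative_add bounded_linear.has_derivative[OF bounded_linear_cscale_right]
        differentiable_imp_has_dir_deriv diff)
  note A = has_derivative_add[OF dz P] and B = has_derivative_add[OF has_derivative_minus[OF dzbar] Q]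
  show "A differentiable at z" "B differentiable at z"
    unfolding A_def B_def by (rule differentiableI[OF A] differentiableI[OF B])+
  \<comment> \<open>This lets the mixed derivative in \<open>d_z B\<close> be rewritten as
    \<open>d_zbar (d_z \<Omega>)\<close>, so that it adds to the one from
    \<open>d_zbar A\<close>.\<close>
  have sym: "?DD \<i> 1 = ?DD 1 \<i>"
    by (rule dir_deriv_symmetric[OF diff])
  have A': "d_zbar A z = d_zbar (d_z \<Omega>) z + cbracket br (d_zbar \<Omega> z) (Ad_exp br (\<Omega> z) W)"
    unfolding A_def d_zbar_eq dir_deriv_eqI[OF A] dir_deriv_eqI[OF dz]
    by (simp add: C.bracket_add_left C.bracket_scale_left C.scale_right_distrib)
  have B': "d_z B z = - d_zbar (d_z \<Omega>) z - cbracket br (d_z \<Omega> z) (Ad_exp br (- \<Omega> z) W')"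
    unfolding d_z_eq[of B] unfolding B_def dir_deriv_eqI[OF B] d_zbar_eq[of "d_z \<Omega>"] d_z_eq[of \<Omega>] dir_deriv_eqI[OF dz]
    by (simp add: C.bracket_diff_left C.bracket_neg_left C.bracket_scale_left C.scale_right_distrib
        C.scale_right_diff_distrib sym)
  \<comment> \<open>Derivatives of \<open>\<Omega>\<close> stay in the abelian Cartan subalgebra,
    which removes the pure derivative term of the bracket of \<open>A\<close> and
    \<open>B\<close>.\<close>
  have "cbracket br (d_z \<Omega> z) (d_zbar \<Omega> z) = 0"
    unfolding d_z_eq d_zbar_eq using D\<hh> subspace_cartan
    by (intro cartan_commute) (simp_all add: C.subspace_diff C.subspace_add C.subspace_scale)
  then show "d_z B z - d_zbar A z + cbracket br (A z) (B z) =
      cbracket br (Ad_exp br (\<Omega> z) W) (Ad_exp br (- \<Omega> z) W') - 2 *\<^sub>R d_zbar (d_z \<Omega>) z"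
    unfolding A' B' unfolding A_def B_def
    using C.bracket_anticommute[of "Ad_exp br (\<Omega> z) W" "d_zbar \<Omega> z"]
    by (simp add: C.bracket_add_left C.bracket_add_right C.bracket_diff_right scaleR_2)
qed

end

theorem lemma4p1:
  fixes br :: "'g::euclidean_space \<Rightarrow> 'g \<Rightarrow> 'g"
    and t :: "'g set"
    and N k :: nat
    and \<alpha> :: "nat \<Rightarrow> 'g complexified \<Rightarrow> complex"
    and \<eta> :: "nat \<Rightarrow> 'g complexified"
    and \<pi> :: "nat \<Rightarrow> nat"
    and Rp Rm :: "nat \<Rightarrow> 'g complexified"
    and r m :: "nat \<Rightarrow> complex"
    and W :: "'g complexified"
    and \<Omega> :: "complex \<Rightarrow> 'g complexified"
  assumes setting: "coxeter_setting br t N \<alpha> \<eta> k \<pi>"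
    and root_vectors:
      "\<forall>j\<in>{0..N}. Rp j \<noteq> 0 \<and> Rp j \<in> lie_algebra.root_space cscale (cbracket br) (complexify t) (\<alpha> j)"
      "\<forall>j\<in>{0..N}. Rm j \<noteq> 0 \<and> Rm j \<in> lie_algebra.root_space cscale (cbracket br) (complexify t) (\<lambda>H. - \<alpha> j H)"
    and conj_root_vectors: "\<forall>j\<in>{0..N}. cconj (Rp j) = Rm (\<pi> j)"
    and W: "W = (\<Sum>j=0..N. cscale (r j) (Rp j))"
    and cyclic: "cyclic_element br t N \<alpha> \<eta> k W"
    and m: "\<forall>j\<in>{0..N}. m j = r j * cnj (r (\<pi> j)) * lie_algebra.killing cscale (cbracket br) (Rp j) (Rm j)"
    and m_conj: "\<forall>j\<in>{0..N}. m (\<pi> j) = cnj (m j)"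
    and Omega: "smooth \<Omega>" "\<forall>z. \<Omega> z \<in> imag_part t"
  shows "affine_toda br t N \<alpha> m \<Omega> \<longleftrightarrow> integrability_condition br W \<Omega>"
proof -
  interpret coxeter_setting br t N \<alpha> \<eta> k \<pi> by (rule setting)
  let ?W' = "\<Sum>j=0..N. cscale (cnj (r (\<pi> j))) (Rm j)"
  have \<Omega>: "\<Omega> z \<in> \<hh>" for z
    using Omega(2) subspace_0[OF cartan_real] by (simp add: imag_part_def complexify_def mem_Times_iff)
  have conj_cscale: "cconj (cscale c X) = cscale (cnj c) (cconj X)" for c and X :: "'g complexified"
    by (simp add: cconj_def cscale_def)
  have conj_sum: "cconj (sum f J) = (\<Sum>j\<in>J. cconj (f j))" for f :: "nat \<Rightarrow> 'g complexified" and J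
    by (simp add: cconj_def prod_eq_iff fst_sum snd_sum sum_negf)
  \<comment> \<open>Conjugation sends the \<open>j\<close>-th term to a multiple of
    \<open>Rm (\<pi> j)\<close>; writing \<open>j\<close> as \<open>\<pi> (\<pi> j)\<close> lets the
    sum be reindexed along \<open>\<pi>\<close>.\<close>
  have W': "cconj W = ?W'"
  proof -
    have "cconj W = (\<Sum>j=0..N. cscale (cnj (r (\<pi> (\<pi> j)))) (Rm (\<pi> j)))"
      unfolding W conj_sum using conj_root_vectors perm_involution
      by (intro sum.cong) (auto simp: conj_cscale)
    also have "\<dots> = ?W'"
      by (rule sum.reindex_bij_betw[OF perm])
    finally show ?thesis .
  qed
  have Rp: "Rp j \<in> C.root_space \<hh> (\<alpha> j) \<and> Rp j \<noteq> 0"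
    and Rm: "Rm j \<in> C.root_space \<hh> (\<lambda>H. - \<alpha> j H) \<and> Rm j \<noteq> 0" if "j \<in> {0..N}" for j
    using root_vectors that by auto
  let ?A = "\<lambda>z. d_z \<Omega> z + Ad_exp br (\<Omega> z) W"
  let ?B = "\<lambda>z. - d_zbar \<Omega> z + Ad_exp br (- \<Omega> z) (cconj W)"
  have curvature: "?A differentiable at z" "?B differentiable at z"
      "d_z ?B z - d_zbar ?A z + cbracket br (?A z) (?B z) =
        cbracket br (Ad_exp br (\<Omega> z) W) (Ad_exp br (- \<Omega> z) (cconj W)) - 2 *\<^sub>R d_zbar (d_z \<Omega>) z" for z
    by (rule toda_curvature[OF Omega(1) \<Omega> Rp Rm W W']; assumption)+
  have bracket: "cbracket br (Ad_exp br (\<Omega> z) W) (Ad_exp br (- \<Omega> z) (cconj W)) =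
      (\<Sum>j=0..N. cscale (m j * exp (2 * \<alpha> j (\<Omega> z))) (C.killing_sharp \<hh> (\<alpha> j)))" for z
  proof -
    \<comment> \<open>The sign of the weight of \<open>Rm j\<close> cancels the sign of
      \<open>- \<Omega> z\<close>, so both factors carry
      \<open>exp (\<alpha> j (\<Omega> z))\<close> and their product has exponent
      \<open>2 * \<alpha> j (\<Omega> z)\<close>.\<close>
    have neg: "- \<alpha> j (- \<Omega> z) = \<alpha> j (\<Omega> z)" if "j \<in> {0..N}" for j
      using C.root_scale[of "Rp j" \<hh> "\<alpha> j" "\<Omega> z" "-1"] Rp[OF that] subspace_cartan \<Omega> by simp
    have P: "Ad_exp br (\<Omega> z) W = (\<Sum>j=0..N. cscale (exp (\<alpha> j (\<Omega> z)) * r j) (Rp j))"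
      unfolding W using Rp by (intro Ad_exp_root_vectors \<Omega>) auto
    have "Ad_exp br (- \<Omega> z) (cconj W) = (\<Sum>j=0..N. cscale (exp (- \<alpha> j (- \<Omega> z)) * cnj (r (\<pi> j))) (Rm j))"
      unfolding W' using Rm by (intro Ad_exp_root_vectors C.subspace_neg[OF subspace_cartan] \<Omega>) auto
    then have Q: "Ad_exp br (- \<Omega> z) (cconj W) = (\<Sum>j=0..N. cscale (exp (\<alpha> j (\<Omega> z)) * cnj (r (\<pi> j))) (Rm j))"
      using neg by simp
    have "cbracket br (Ad_exp br (\<Omega> z) W) (Ad_exp br (- \<Omega> z) (cconj W)) =
        (\<Sum>j=0..N. \<Sum>l=0..N. cscale (exp (\<alpha> j (\<Omega> z)) * r j * (exp (\<alpha> l (\<Omega> z)) * cnj (r (\<pi> l))))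
          (cbracket br (Rp j) (Rm l)))"
      unfolding P Q C.bracket_sum_left
      by (simp add: C.bracket_sum_right C.bracket_scale_left C.bracket_scale_right C.scale_sum_right mult_ac)
    also have "\<dots> = (\<Sum>j=0..N. \<Sum>l=0..N. if j = l then
        cscale (m j * exp (2 * \<alpha> j (\<Omega> z))) (C.killing_sharp \<hh> (\<alpha> j)) else 0)"
    proof (intro sum.cong refl)
      fix j l assume j: "j \<in> {0..N}" and l: "l \<in> {0..N}"
      have "exp (2 * \<alpha> j (\<Omega> z)) = exp (\<alpha> j (\<Omega> z)) * exp (\<alpha> j (\<Omega> z))"
        by (simp only: mult_2 exp_add)
      then show "cscale (exp (\<alpha> j (\<Omega> z)) * r j * (exp (\<alpha> l (\<Omega> z)) * cnj (r (\<pi> l)))) (cbracket br (Rp j) (Rm l)) =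
          (if j = l then cscale (m j * exp (2 * \<alpha> j (\<Omega> z))) (C.killing_sharp \<hh> (\<alpha> j)) else 0)"
        using bracket_affine_root_vectors[OF j l, of "Rp j" "Rm l"] Rp[OF j] Rm[OF l] m j
        by (auto simp: mult_ac)
    qed
    finally show ?thesis by simp
  qed
  have "integrability_condition br W \<Omega> \<longleftrightarrow>
      (\<forall>z. cbracket br (Ad_exp br (\<Omega> z) W) (Ad_exp br (- \<Omega> z) (cconj W)) - 2 *\<^sub>R d_zbar (d_z \<Omega>) z = 0)"
    unfolding integrability_condition_def toda_form_def[abs_def]
    unfolding maurer_cartan_iff[OF curvature(1,2)] curvature(3) ..
  also have "\<dots> \<longleftrightarrow> affine_toda br t N \<alpha> m \<Omega>"
    unfolding affine_toda_def bracket right_minus_eq by (rule all_cong1) (rule eq_commute)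
  finally show ?thesis by simp
qed

end
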